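(* Let $\alpha>0$. Let $k$ run through even positive integers tending to infinity and let $m=m(k)$ be positive integers with $m=\alpha k+o(k)$. Then there exists a constant $P_\rho(\alpha)>0$ such that the number of zeros of $P_{k,m}$ on $\mathcal{L}_\rho$ is at least $P_\rho(\alpha)\frac{k}{12}+o(k)$. In particular, a positive proportion of the zeros of $P_{k,m}$ in $\mathcal{F}$ lie on $\mathcal{L}_\rho$.
   Context: $\mathbb{H}=\{z:\operatorname{Im} z>0\}$. For even $k$ and integer $m\ge 1$, the Poincaré series is $P_{k,m}(z)=\frac12\sum_{c,d\in\mathbb{Z},\ \gcd(c,d)=1}\frac{\exp(2\pi i m\gamma z)}{(cz+d)^k}$, where for each coprime pair $(c,d)$, $\gamma=\begin{pmatrix}a&b\\c&d\end{pmatrix}$ is any matrix in $\mathrm{SL}(2,\mathbb{Z})$ with bottom row $(c,d)$ and $\gamma z=\frac{az+b}{cz+d}$; it is a cusp form of weight $k$ for $\mathrm{SL}(2,\mathbb{Z})$. The fundamental domain is $\mathcal{F}=\{z\in\mathbb{H}: |z|>1,\ \operatorname{Re} z\in(-\frac12,\frac12]\}\cup\{z\in\mathbb{H}:|z|=1,\ \arg z\in[\frac{\pi}{3},\frac{\pi}{2}]\}$. $\mathcal{L}_\rho=\{\frac12+ti: t\ge \frac{\sqrt3}{2}\}$. All asymptotic notation refers to $k\to\infty$, with implied constants allowed to depend on $\alpha$. *)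

theory Defs
  imports "HOL-Complex_Analysis.Complex_Analysis" "HOL-Library.Landau_Symbols"
begin

definition upper_half_plane :: "complex set" where
  "upper_half_plane = {z. Im z > 0}"

text \<open>A choice of top row for a matrix in \<open>SL(2,\<int>)\<close> with bottom row \<open>(c, d)\<close>; see
  \<open>poincare_term_eq\<close> below for the independence of this choice.\<close>

definition top_row :: "int \<Rightarrow> int \<Rightarrow> int \<times> int" where
  "top_row c d = (SOME (a, b). a * d - b * c = 1)"

definition poincare_term :: "nat \<Rightarrow> nat \<Rightarrow> complex \<Rightarrow> int \<times> int \<Rightarrow> complex" where
  "poincare_term k m z = (\<lambda>(c, d). case top_row c d of (a, b) \<Rightarrow>
     exp (2 * of_real pi * \<i> * of_nat m * moebius (of_int a) (of_int b) (of_int c) (of_int d) z) / (of_int c * z + of_int d) ^ k)"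

text \<open>The sum is unconditional; it converges for even \<open>k \<ge> 4\<close> and \<open>z\<close> in the upper half plane.\<close>

definition poincare_series :: "nat \<Rightarrow> nat \<Rightarrow> complex \<Rightarrow> complex" where
  "poincare_series k m z = 1 / 2 * (\<Sum>\<^sub>\<infinity>cd\<in>{(c, d). coprime c d}. poincare_term k m z cd)"

lemma top_row_det:
  assumes "coprime c d" "top_row c d = (a, b)"
  shows "a * d - b * c = 1"
proof -
  obtain u v where uv: "u * d + v * c = 1"
    using bezout_int[of d c] assms(1) by (auto simp: coprime_iff_gcd_eq_1 gcd.commute)
  have "case (u, - v) of (a, b) \<Rightarrow> a * d - b * c = 1"
    using uv by simp
  hence "case top_row c d of (a, b) \<Rightarrow> a * d - b * c = 1"
    unfolding top_row_def by (rule someI)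
  thus ?thesis using assms(2) by simp
qed

lemma poincare_term_eq:
  assumes z: "z \<in> upper_half_plane" and det: "a * d - b * c = 1"
  shows "poincare_term k m z (c, d) =
    exp (2 * of_real pi * \<i> * of_nat m * moebius (of_int a) (of_int b) (of_int c) (of_int d) z) / (of_int c * z + of_int d) ^ k"
proof -
  obtain a' b' where ab': "top_row c d = (a', b')" by force
  have cop: "coprime c d"
  proof (rule coprimeI)
    fix e assume "e dvd c" "e dvd d"
    hence "e dvd a * d - b * c" by simp
    thus "is_unit e" using det by simp
  qed
  have det': "a' * d - b' * c = 1" using top_row_det[OF cop ab'] .
  define t where "t = a' * b - a * b'"
  have a: "a = a' + t * c" unfolding t_def using det det' by algebra
  have b: "b = b' + t * d" unfolding t_def using det det' by algebra
  have nz: "of_int c * z + of_int d \<noteq> 0"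
  proof
    assume eq: "of_int c * z + of_int d = 0"
    have "c = 0" using z arg_cong[OF eq, of Im] by (simp add: upper_half_plane_def)
    with eq det show False by simp
  qed
  have "moebius (of_int a) (of_int b) (of_int c) (of_int d) z = moebius (of_int a') (of_int b') (of_int c) (of_int d) z + of_int t"
    using nz by (simp add: moebius_def a b field_simps)
  hence "2 * of_real pi * \<i> * of_nat m * moebius (of_int a) (of_int b) (of_int c) (of_int d) z =
    2 * of_real pi * \<i> * of_nat m * moebius (of_int a') (of_int b') (of_int c) (of_int d) z + of_int (2 * (int m * t)) * (of_real pi * \<i>)"
    by (simp add: algebra_simps)
  hence "exp (2 * of_real pi * \<i> * of_nat m * moebius (of_int a) (of_int b) (of_int c) (of_int d) z) =
    exp (2 * of_real pi * \<i> * of_nat m * moebius (of_int a') (of_int b') (of_int c) (of_int d) z)"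
    unfolding exp_eq by (intro exI[of _ "int m * t"]) simp
  thus ?thesis by (simp add: poincare_term_def ab')
qed

definition fundamental_domain :: "complex set" where
  "fundamental_domain =
     {z \<in> upper_half_plane. norm z > 1 \<and> Re z \<in> {-1/2<..1/2}} \<union>
     {z \<in> upper_half_plane. norm z = 1 \<and> Arg z \<in> {pi/3..pi/2}}"

definition L_rho :: "complex set" where
  "L_rho = {1 / 2 + of_real t * \<i> | t :: real. t \<ge> sqrt 3 / 2}"

definition zeros_in :: "(complex \<Rightarrow> complex) \<Rightarrow> complex set \<Rightarrow> complex set" where
  "zeros_in f S = {z \<in> S. f z = 0}"

definition zeros_with_mult :: "(complex \<Rightarrow> complex) \<Rightarrow> complex set \<Rightarrow> int" where
  "zeros_with_mult f S = (\<Sum>z\<in>zeros_in f S. zorder f z)"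

definition even_at_top :: "nat filter" where
  "even_at_top = inf at_top (principal {k. even k})"

end

theory Submission
  imports Defs
begin

text \<open>
  On the line \<open>z = 1/2 + it\<close> the series is real. For \<open>t\<close> in an interval \<open>[T, T + 1]\<close> with \<open>T\<close> large
  in terms of \<open>\<alpha>\<close>, the terms of \<open>(c, d) = \<plusminus>(1, 0), \<plusminus>(1, -1)\<close> dominate exponentially: the term of
  \<open>(c, d)\<close> has modulus \<open>s\<^sup>-\<^sup>k\<^sup>/\<^sup>2 exp (- 2 \<pi> m t / s)\<close> with \<open>s = |cz + d|\<^sup>2\<close>, which decreases for
  \<open>s \<ge> |z|\<^sup>2\<close>, and \<open>(0, \<plusminus>1)\<close> contributes only \<open>exp (- 2 \<pi> m t)\<close>. The dominant terms add up to a positive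
  amplitude times \<open>2 cos \<theta>(t)\<close>, where the phase \<open>\<theta>\<close> grows by a constant times \<open>k\<close> on the interval, so
  there are at least a constant times \<open>k\<close> sign changes.

  For the proportion, an upper bound linear in \<open>k\<close> replaces the valence formula. The series is a
  holomorphic function of \<open>q = exp (2 \<pi> i z)\<close>, the fundamental domain lies in \<open>|q| \<le> exp (- \<pi> \<surd>3)\<close>, and
  dividing out the zeros there and applying the maximum principle on a larger disc bounds their
  number by the logarithm of an upper bound \<open>exp (O(k))\<close> over a value of size \<open>exp (- O(k))\<close>.
\<close>

subsection \<open>Counting zeros in a disc\<close>

text \<open>The points of \<open>Z\<close> are divided out one at a time. Connectedness and the
  point \<open>w0\<close> exclude an \<open>f\<close> that vanishes identically, so each
  \<open>zorder\<close> comes from a local factorization with finite exponent.\<close>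

lemma holomorphic_factor_zeros:
  assumes holf: "f holomorphic_on S" and S: "open S" "connected S"
    and nz: "w0 \<in> S" "f w0 \<noteq> 0"
    and Z: "finite Z" "Z \<subseteq> S"
  obtains h where "h holomorphic_on S"
    "\<And>z. z \<in> S \<Longrightarrow> f z = h z * (\<Prod>w\<in>Z. (z - w) ^ nat (zorder f w))"
proof -
  have "\<exists>h. h holomorphic_on S \<and> (\<forall>z\<in>S. f z = h z * (\<Prod>w\<in>Z. (z - w) ^ nat (zorder f w)))"
    using Z
  proof (induction Z rule: finite_induct)
    case empty
    then show ?case using holf by auto
  next
    case (insert w Z)
    define p where "p z = (\<Prod>w\<in>Z. (z - w) ^ nat (zorder f w))" for z
    define n where "n = nat (zorder f w)"
    obtain h where h: "h holomorphic_on S" "\<And>z. z \<in> S \<Longrightarrow> f z = h z * p z"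
      using insert by (auto simp: p_def)
    have w: "w \<in> S" using insert by auto
    obtain r where r: "r > 0" "cball w r \<subseteq> S" "zor_poly f w holomorphic_on cball w r"
      "\<And>u. u \<in> cball w r \<Longrightarrow> f u = zor_poly f w u * (u - w) ^ n"
      using zorder_exist_zero[OF holf S w] nz unfolding n_def by blast
    define g where "g = zor_poly f w"
    have pw: "p w \<noteq> 0"
      unfolding p_def using insert by auto
    have contp: "isCont p w"
      unfolding p_def by (intro continuous_intros)
    have contg: "isCont g w"
      using r(1) holomorphic_on_imp_continuous_on[OF r(3)] unfolding g_def
      by (meson ball_subset_cball centre_in_ball continuous_on_eq_continuous_at continuous_on_subset open_ball)
    \<comment> \<open>Near \<open>w\<close> both factorizations give
      \<open>h * p = g * (u - w) ^ n\<close>, and \<open>p w\<close> is nonzero because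
      \<open>w\<close> is not in \<open>Z\<close>. Hence the quotient agrees with
      \<open>g / p\<close> and its singularity is removable.\<close>
    have lim: "((\<lambda>u. h u / (u - w) ^ n) \<longlongrightarrow> g w / p w) (at w)"
    proof (rule Lim_transform_eventually)
      show "((\<lambda>u. g u / p u) \<longlongrightarrow> g w / p w) (at w)"
        using contp contg pw by (intro tendsto_divide) (auto simp: isCont_def)
      have "eventually (\<lambda>u. p u \<noteq> 0) (at w)"
        using contp pw by (auto simp: isCont_def intro: tendsto_imp_eventually_ne)
      moreover have "eventually (\<lambda>u. u \<in> ball w r - {w}) (at w)"
        using r(1) eventually_at_ball'[of r w UNIV] by auto
      ultimately show "eventually (\<lambda>u. g u / p u = h u / (u - w) ^ n) (at w)"
      proof eventually_elim
        case (elim u)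
        hence u: "u \<in> cball w r" "u \<noteq> w" by auto
        have "h u * p u = g u * (u - w) ^ n"
          using r(4)[OF u(1)] h(2)[of u] r(2) u by (auto simp: g_def)
        thus ?case using elim u by (simp add: field_simps)
      qed
    qed
    define h' where "h' = (\<lambda>u. if u = w then g w / p w else h u / (u - w) ^ n)"
    have "h' holomorphic_on S"
      unfolding h'_def using S(1) lim
      by (intro removable_singularity holomorphic_intros holomorphic_on_subset[OF h(1)]) auto
    moreover have "f z = h' z * ((z - w) ^ n * p z)" if "z \<in> S" for z
    proof (cases "z = w")
      case True
      thus ?thesis using r(4)[of w] r(1) pw by (simp add: h'_def g_def)
    next
      case False
      thus ?thesis using h(2)[OF that] by (simp add: h'_def)
    qed
    ultimately show ?case
      using insert by (intro exI[of _ h']) (auto simp: p_def n_def)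
  qed
  thus ?thesis using that by blast
qed

text \<open>A variant of Jensen's inequality. With the zeros divided out, the maximum principle on
  the circle of radius \<open>R\<close> bounds the quotient by \<open>M / (R - \<rho>) ^ N\<close>,
  while at \<open>w0\<close> the removed product is at most \<open>(2 * \<rho>) ^ N\<close>. The
  condition \<open>3 * \<rho> < R\<close> makes the logarithm positive, so that it bounds the number
  of zeros.\<close>

lemma zero_count_disc:
  assumes holf: "f holomorphic_on ball 0 R'" and bound: "\<And>z. z \<in> ball 0 R' \<Longrightarrow> norm (f z) \<le> M"
    and R: "0 < \<rho>" "3 * \<rho> < R" "R < R'"
    and nz: "norm w0 \<le> \<rho>" "f w0 \<noteq> 0"
  shows "finite {w \<in> cball 0 \<rho>. f w = 0}"
    and "of_int (\<Sum>w | w \<in> cball 0 \<rho> \<and> f w = 0. zorder f w) * ln ((R - \<rho>) / (2 * \<rho>)) \<le> ln (M / norm (f w0))"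
    and "w \<in> ball 0 R' \<Longrightarrow> f w = 0 \<Longrightarrow> zorder f w > 0"
proof -
  define Z where "Z = {w \<in> cball 0 \<rho>. f w = 0}"
  have w0: "w0 \<in> ball 0 R'" using R nz by auto
  show fin: "finite {w \<in> cball 0 \<rho>. f w = 0}"
  proof (cases "f constant_on ball 0 R'")
    case True
    hence "{w \<in> cball 0 \<rho>. f w = 0} = {}"
      using nz w0 R unfolding constant_on_def by fastforce
    thus ?thesis by (metis finite.emptyI)
  next
    case False
    thus ?thesis
      using R by (intro holomorphic_compact_finite_zeros[OF holf]) auto
  qed
  have Zsub: "Z \<subseteq> ball 0 R'" using R by (auto simp: Z_def)
  have pos: "zorder f w > 0" if "w \<in> ball 0 R'" "f w = 0" for w
  proof -
    have "\<exists>u\<in>ball 0 R'. f u \<noteq> 0" using nz w0 by blast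
    from conjunct1[OF zorder_exist_zero[OF holf open_ball connected_ball that(1) this]] that(2)
    show ?thesis by simp
  qed
  thus "w \<in> ball 0 R' \<Longrightarrow> f w = 0 \<Longrightarrow> zorder f w > 0" .
  obtain h where h: "h holomorphic_on ball 0 R'"
    "\<And>z. z \<in> ball 0 R' \<Longrightarrow> f z = h z * (\<Prod>w\<in>Z. (z - w) ^ nat (zorder f w))"
    using holomorphic_factor_zeros[OF holf open_ball connected_ball w0 nz(2) _ Zsub] fin
    unfolding Z_def by metis
  define N where "N = (\<Sum>w\<in>Z. nat (zorder f w))"
  define M' where "M' = M / (R - \<rho>) ^ N"
  have Mpos: "M > 0" using bound[OF w0] nz(2) by (smt (verit) zero_less_norm_iff)
  have "norm (h w0) \<le> M'"
  proof (rule maximum_modulus_frontier[of h "cball 0 R"])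
    show "h holomorphic_on interior (cball 0 R)"
      using R by (intro holomorphic_on_subset[OF h(1)]) auto
    show "continuous_on (closure (cball 0 R)) h"
      using R by (intro holomorphic_on_imp_continuous_on holomorphic_on_subset[OF h(1)]) auto
    fix z :: complex assume "z \<in> frontier (cball 0 R)"
    hence z: "norm z = R" using R by (simp add: frontier_cball)
    have "(R - \<rho>) ^ N = (\<Prod>w\<in>Z. (R - \<rho>) ^ nat (zorder f w))"
      by (simp add: N_def power_sum)
    also have "\<dots> \<le> (\<Prod>w\<in>Z. norm (z - w) ^ nat (zorder f w))"
    proof (intro prod_mono conjI power_mono)
      fix w assume "w \<in> Z"
      thus "R - \<rho> \<le> norm (z - w)"
        using z norm_triangle_ineq2[of z w] by (auto simp: Z_def)
    qed (use R in auto)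
    also have "\<dots> = norm (\<Prod>w\<in>Z. (z - w) ^ nat (zorder f w))"
      by (simp add: norm_power flip: prod_norm)
    finally have "norm (h z) * (R - \<rho>) ^ N \<le> norm (f z)"
      using h(2)[of z] z R by (simp add: norm_mult mult_left_mono)
    also have "\<dots> \<le> M" using z R by (intro bound) auto
    finally show "norm (h z) \<le> M'"
      using R by (simp add: M'_def field_simps)
  qed (use R nz in auto)
  moreover have "norm (\<Prod>w\<in>Z. (w0 - w) ^ nat (zorder f w)) \<le> (2 * \<rho>) ^ N"
  proof -
    have "norm (\<Prod>w\<in>Z. (w0 - w) ^ nat (zorder f w)) = (\<Prod>w\<in>Z. norm (w0 - w) ^ nat (zorder f w))"
      by (simp add: norm_power flip: prod_norm)
    also have "\<dots> \<le> (\<Prod>w\<in>Z. (2 * \<rho>) ^ nat (zorder f w))"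
    proof (intro prod_mono conjI power_mono)
      fix w assume "w \<in> Z"
      thus "norm (w0 - w) \<le> 2 * \<rho>"
        using nz norm_triangle_ineq4[of w0 w] by (auto simp: Z_def)
    qed auto
    finally show ?thesis by (simp add: N_def power_sum)
  qed
  ultimately have "norm (h w0) * norm (\<Prod>w\<in>Z. (w0 - w) ^ nat (zorder f w)) \<le> M' * (2 * \<rho>) ^ N"
    using Mpos R by (intro mult_mono) (auto simp: M'_def)
  hence "norm (f w0) \<le> M' * (2 * \<rho>) ^ N"
    by (simp only: h(2)[OF w0] norm_mult)
  hence "((R - \<rho>) / (2 * \<rho>)) ^ N \<le> M / norm (f w0)"
    using R nz by (simp add: M'_def field_simps)
  hence "ln (((R - \<rho>) / (2 * \<rho>)) ^ N) \<le> ln (M / norm (f w0))"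
    using R Mpos nz by (subst ln_le_cancel_iff) auto
  hence "real N * ln ((R - \<rho>) / (2 * \<rho>)) \<le> ln (M / norm (f w0))"
    using R by (simp add: ln_realpow)
  moreover have "real N = of_int (\<Sum>w\<in>Z. zorder f w)"
  proof -
    \<comment> \<open>\<open>nat\<close> truncates nothing here, since the orders at zeros are
      positive.\<close>
    have "int N = (\<Sum>w\<in>Z. zorder f w)"
      unfolding N_def of_nat_sum using pos Zsub by (intro sum.cong) (force simp: Z_def)+
    thus ?thesis by (metis of_int_of_nat_eq)
  qed
  ultimately show "of_int (\<Sum>w | w \<in> cball 0 \<rho> \<and> f w = 0. zorder f w) * ln ((R - \<rho>) / (2 * \<rho>)) \<le> ln (M / norm (f w0))"
    by (simp add: Z_def)
qed

subsection \<open>Periodic functions and the nome\<close>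

abbreviation nome :: "complex \<Rightarrow> complex" where
  "nome z \<equiv> exp (2 * of_real pi * \<i> * z)"

lemma periodic_of_int:
  assumes per: "\<And>z. Im z > y \<Longrightarrow> f (z + 1) = f z" and "Im z > y"
  shows "f (z + of_int n) = (f z :: complex)"
proof (cases n rule: int_cases2)
  case (nonneg j)
  have "f (z + of_nat j) = f z"
    using per[of "z + of_nat _"] assms(2) by (induction j) (auto simp: add_ac)
  thus ?thesis using nonneg by simp
next
  case (nonpos j)
  have "f (z - of_nat j) = f z"
  proof (induction j)
    case (Suc j)
    thus ?case using per[of "z - of_nat (Suc j)"] assms(2) by (auto simp: algebra_simps)
  qed auto
  thus ?thesis using nonpos by simp
qed

text \<open>Two branches of the logarithm, cut along opposite half-axes, cover the punctured disc.
  By periodicity they define the same function of \<open>q\<close>, and boundedness removes the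
  singularity at \<open>q = 0\<close>.\<close>

lemma periodic_factor_nome:
  assumes hol: "f holomorphic_on {z. Im z > y}" and per: "\<And>z. Im z > y \<Longrightarrow> f (z + 1) = f z"
    and bound: "\<And>z. Im z > y \<Longrightarrow> norm (f z) \<le> M"
  obtains F where "F holomorphic_on ball 0 (exp (- 2 * pi * y))"
    "\<And>z. Im z > y \<Longrightarrow> F (nome z) = f z"
    "\<And>q. q \<in> ball 0 (exp (- 2 * pi * y)) \<Longrightarrow> norm (F q) \<le> M"
proof -
  define B where "B = (ball 0 (exp (- 2 * pi * y)) :: complex set)"
  define G where "G q = f (Ln q / (2 * of_real pi * \<i>))" for q
  have Im_iff: "Im z > y \<longleftrightarrow> nome z \<in> B" for z
    by (simp add: B_def norm_exp_eq_Re)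
  have G: "G (nome z) = f z" if "Im z > y" for z
  proof -
    define w where "w = Ln (nome z) / (2 * of_real pi * \<i>)"
    have "nome w = nome z" by (simp add: w_def)
    then obtain n where n: "2 * of_real pi * \<i> * w = 2 * of_real pi * \<i> * z + of_int (2 * n) * of_real pi * \<i>"
      unfolding exp_eq by auto
    hence "2 * of_real pi * \<i> * w = 2 * of_real pi * \<i> * (z + of_int n)"
      by (simp add: algebra_simps)
    hence "w = z + of_int n" by simp
    thus ?thesis using periodic_of_int[of y f z n] per that by (simp add: G_def w_def)
  qed
  have hol1: "G holomorphic_on B - \<real>\<^sub>\<le>\<^sub>0"
    unfolding G_def
  proof (rule holomorphic_on_compose_gen[OF _ hol, unfolded o_def])
    show "(\<lambda>q. Ln q / (2 * of_real pi * \<i>)) holomorphic_on B - \<real>\<^sub>\<le>\<^sub>0"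
      by (intro holomorphic_intros) auto
    have "nome (Ln q / (2 * of_real pi * \<i>)) = q" if "q \<in> B - \<real>\<^sub>\<le>\<^sub>0" for q
      using that by (auto intro!: exp_Ln)
    thus "(\<lambda>q. Ln q / (2 * of_real pi * \<i>)) ` (B - \<real>\<^sub>\<le>\<^sub>0) \<subseteq> {z. y < Im z}"
      using Im_iff by (metis (no_types, lifting) DiffD1 image_subsetI mem_Collect_eq)
  qed
  \<comment> \<open>The branch cut along the positive axis: the shift by 1/2 multiplies the nome by
    -1 and so undoes the sign in \<open>Ln (- q)\<close>.\<close>
  define \<psi> where "\<psi> q = Ln (- q) / (2 * of_real pi * \<i>) + 1 / 2" for q
  have nome_\<psi>: "nome (\<psi> q) = q" if "q \<noteq> 0" for q
    using that by (simp add: \<psi>_def ring_distribs exp_add)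
  have hol2: "G holomorphic_on B - \<real>\<^sub>\<ge>\<^sub>0"
  proof (rule holomorphic_transform)
    show "(\<lambda>q. f (\<psi> q)) holomorphic_on B - \<real>\<^sub>\<ge>\<^sub>0"
    proof (rule holomorphic_on_compose_gen[OF _ hol, unfolded o_def])
      show "\<psi> holomorphic_on B - \<real>\<^sub>\<ge>\<^sub>0"
        unfolding \<psi>_def by (intro holomorphic_intros) (auto simp: uminus_nonneg_Reals_iff complex_nonpos_Reals_iff complex_nonneg_Reals_iff)
      show "\<psi> ` (B - \<real>\<^sub>\<ge>\<^sub>0) \<subseteq> {z. y < Im z}"
      proof
        fix z assume "z \<in> \<psi> ` (B - \<real>\<^sub>\<ge>\<^sub>0)"
        then obtain q where q: "q \<in> B" "q \<notin> \<real>\<^sub>\<ge>\<^sub>0" "z = \<psi> q" by auto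
        hence "q \<noteq> 0" by auto
        thus "z \<in> {z. y < Im z}" using q nome_\<psi>[of q] Im_iff[of z] by simp
      qed
    qed
    show "f (\<psi> q) = G q" if "q \<in> B - \<real>\<^sub>\<ge>\<^sub>0" for q
    proof -
      have "q \<noteq> 0" using that by auto
      thus ?thesis using that nome_\<psi>[of q] G[of "\<psi> q"] Im_iff[of "\<psi> q"] by simp
    qed
  qed
  have "G holomorphic_on (B - \<real>\<^sub>\<le>\<^sub>0) \<union> (B - \<real>\<^sub>\<ge>\<^sub>0)"
    using hol1 hol2 by (intro holomorphic_on_Un) (auto simp: B_def intro!: open_Diff)
  moreover have "(B - \<real>\<^sub>\<le>\<^sub>0) \<union> (B - \<real>\<^sub>\<ge>\<^sub>0) = B - {0}"
    by (auto simp: complex_nonpos_Reals_iff complex_nonneg_Reals_iff complex_eq_iff)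
  ultimately have holG: "G holomorphic_on B - {0}" by simp
  have ln: "Im (Ln q / (2 * of_real pi * \<i>)) > y \<and> nome (Ln q / (2 * of_real pi * \<i>)) = q" if "q \<in> B - {0}" for q
    using that by (subst Im_iff) auto
  have bndG: "norm (G q) \<le> M" if "q \<in> B - {0}" for q
    using bound ln[OF that] by (simp add: G_def)
  have 0: "0 \<in> interior B" by (simp add: B_def)
  have evB: "eventually (\<lambda>q. q \<in> B - {0}) (at 0)"
    using eventually_at_ball'[of "exp (- 2 * pi * y)" "0 :: complex" UNIV] by (auto simp: B_def elim!: eventually_mono)
  have "\<forall>\<^sub>F q in at 0. norm (G q) \<le> M"
    using evB by eventually_elim (rule bndG)
  then obtain F where F: "F holomorphic_on B" "\<And>q. q \<in> B - {0} \<Longrightarrow> F q = G q"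
    using holomorphic_on_extend_bounded[OF holG 0] by blast
  show ?thesis
  proof
    show "F holomorphic_on ball 0 (exp (- 2 * pi * y))" using F(1) by (simp add: B_def)
    show "F (nome z) = f z" if "Im z > y" for z
      using that F(2)[of "nome z"] G[OF that] Im_iff[of z] by simp
    show "norm (F q) \<le> M" if "q \<in> ball 0 (exp (- 2 * pi * y))" for q
    proof (cases "q = 0")
      case False
      thus ?thesis using that F(2)[of q] bndG[of q] by (simp add: B_def)
    next
      case True
      \<comment> \<open>At the added point the bound is inherited from the punctured disc by
        continuity.\<close>
      have "isCont F 0" using F(1) 0 
        by (metis B_def continuous_on_interior holomorphic_on_imp_continuous_on)
      hence "((\<lambda>q. norm (F q)) \<longlongrightarrow> norm (F 0)) (at 0)"
        by (intro tendsto_norm) (simp add: isCont_def)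
      moreover have "eventually (\<lambda>q. norm (F q) \<le> M) (at 0)"
        using evB by eventually_elim (use F(2) bndG in auto)
      ultimately show ?thesis using True
        by (auto intro: tendsto_upperbound)
    qed
  qed
qed

text \<open>The derivative of the nome never vanishes, so the substitution is locally biholomorphic
  and preserves orders.\<close>

lemma zorder_compose_nome:
  assumes hol: "F holomorphic_on B" "open B" "connected B" and nz: "w0 \<in> B" "F w0 \<noteq> 0"
    and z: "nome z \<in> B"
  shows "zorder (\<lambda>z. F (nome z)) z = zorder F (nome z)"
proof -
  have an: "F analytic_on {nome z}"
    using hol z analytic_at by blast
  have an': "nome analytic_on {z}" by (intro analytic_intros)
  have "zorder (F \<circ> nome) z = zorder F (nome z) * zorder (\<lambda>x. nome x - nome z) z"
  proof (rule zorder_compose')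
    show "\<forall>\<^sub>F w in at (nome z). F w \<noteq> 0"
      using non_zero_neighbour_alt[OF hol z nz] by (auto elim: eventually_mono)
    \<comment> \<open>Two different values of the nome cannot both equal \<open>nome z\<close>, so
      \<open>nome w - nome z\<close> does not vanish identically and its zeros are isolated.\<close>
    have "nome (1 / 2) = - 1" "nome 0 = 1" by simp_all
    hence "nome (1 / 2) - nome z \<noteq> 0 \<or> nome 0 - nome z \<noteq> 0"
      by (metis one_neq_neg_one right_minus_eq)
    then obtain b where "nome b - nome z \<noteq> 0" by blast
    have "(\<lambda>w. nome w - nome z) holomorphic_on UNIV" by (intro holomorphic_intros)
    from non_zero_neighbour_alt[OF this open_UNIV connected_UNIV UNIV_I UNIV_I \<open>nome b - nome z \<noteq> 0\<close>]
    show "\<forall>\<^sub>F w in at z. nome w \<noteq> nome z"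
      by (auto elim!: eventually_mono)
  qed (use an an' in \<open>auto intro: isolated_singularity_at_analytic not_essential_analytic\<close>)
  moreover have "zorder (\<lambda>x. nome x - nome z) z = 1"
  proof (rule zorder_zero_eqI')
    show "(\<lambda>x. nome x - nome z) analytic_on {z}" by (intro analytic_intros)
    have "deriv (\<lambda>x. nome x - nome z) z = 2 * of_real pi * \<i> * nome z"
      by (rule DERIV_imp_deriv) (auto intro!: derivative_eq_intros)
    thus "(deriv ^^ nat 1) (\<lambda>x. nome x - nome z) z \<noteq> 0" by simp
  qed auto
  ultimately show ?thesis by (simp add: o_def)
qed

subsection \<open>Convergence of the series\<close>

lemma Im_moebius_int:
  fixes a b c d :: int
  assumes "a * d - b * c = 1"
  shows "Im (moebius (of_int a) (of_int b) (of_int c) (of_int d) z) = Im z / norm (of_int c * z + of_int d) ^ 2"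
proof -
  have "moebius (of_int a) (of_int b) (of_int c) (of_int d) z =
      (of_int a * z + of_int b) * cnj (of_int c * z + of_int d) / of_real (norm (of_int c * z + of_int d) ^ 2)"
    unfolding moebius_def by (subst complex_div_cnj) simp
  also have "Im \<dots> = Im ((of_int a * z + of_int b) * cnj (of_int c * z + of_int d)) / norm (of_int c * z + of_int d) ^ 2"
    by (rule Im_divide_of_real)
  also have "Im ((of_int a * z + of_int b) * cnj (of_int c * z + of_int d)) = of_int (a * d - b * c) * Im z"
    by (simp add: algebra_simps)
  finally show ?thesis using assms by simp
qed

lemma norm_poincare_term:
  assumes "Im z > 0" "coprime c d"
  shows "norm (poincare_term k m z (c, d)) =
    exp (- (2 * pi * m * Im z / norm (of_int c * z + of_int d) ^ 2)) / norm (of_int c * z + of_int d) ^ k"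
proof -
  obtain a b where ab: "top_row c d = (a, b)" by force
  show ?thesis
    using Im_moebius_int[OF top_row_det[OF assms(2) ab], of z]
    by (simp add: poincare_term_def ab norm_divide norm_power norm_exp_eq_Re mult_ac)
qed

text \<open>The height 1/4 lies well below sqrt 3 / 2, the least height in the fundamental domain.
  This leaves room in the \<open>q\<close>-disc for the zero count.\<close>

lemma norm_linear_ge:
  assumes "Im z > 1 / 4" "coprime c d"
  shows "norm (of_int c * z + of_int d) \<ge> 1 / 4"
proof (cases "c = 0")
  case True
  hence "\<bar>d\<bar> = 1" using assms by simp
  thus ?thesis using True by (simp flip: of_int_abs)
next
  case False
  hence "1 \<le> \<bar>real_of_int c\<bar>" by linarith
  hence "1 * (1/4) \<le> \<bar>of_int c\<bar> * Im z" using assms by (intro mult_mono) auto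
  also have "\<dots> = \<bar>Im (of_int c * z + of_int d)\<bar>" using assms by (simp add: abs_mult)
  also have "\<dots> \<le> norm (of_int c * z + of_int d)" by (rule abs_Im_le_cmod)
  finally show ?thesis by simp
qed

text \<open>A majorant for \<open>|cz + d|\<close> to the power -4 up to a constant, shaped as a
  product so that summability over pairs reduces to one variable.\<close>

definition lattice_weight :: "int \<times> int \<Rightarrow> real" where
  "lattice_weight = (\<lambda>(c, d). inverse (1 + of_int c ^ 2) * inverse (1 + of_int d ^ 2))"

lemma lattice_weight_nonneg: "lattice_weight cd \<ge> 0"
  by (cases cd) (auto simp: lattice_weight_def)

lemma summable_inverse_one_plus_square_int:
  "(\<lambda>n :: int. inverse (1 + of_int n ^ 2) :: real) summable_on UNIV"
proof -
  define f where "f = (\<lambda>n :: int. inverse (1 + of_int n ^ 2) :: real)"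
  have "summable (\<lambda>n. inverse (1 + real n ^ 2))"
  proof (rule summable_comparison_test_ev)
    show "summable (\<lambda>n. inverse (real n ^ 2))"
      by (rule inverse_power_summable) auto
    show "\<forall>\<^sub>F n in sequentially. norm (inverse (1 + real n ^ 2)) \<le> inverse (real n ^ 2)"
      using eventually_gt_at_top[of 0] by eventually_elim (auto intro!: le_imp_inverse_le)
  qed
  hence nat: "(\<lambda>n. inverse (1 + real n ^ 2)) summable_on UNIV"
    by (subst summable_on_UNIV_nonneg_real_iff) auto
  have "f summable_on range int"
    using nat by (subst summable_on_reindex) (auto simp: f_def o_def)
  moreover have "f summable_on range (\<lambda>n. - int n)"
    using nat by (subst summable_on_reindex) (auto simp: f_def o_def inj_on_def)
  ultimately have "f summable_on range int \<union> range (\<lambda>n. - int n)"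
    by (rule summable_on_union)
  moreover have "range int \<union> range (\<lambda>n. - int n) = UNIV"
    by (metis (no_types, lifting) UNIV_eq_I UnI1 UnI2 int_cases2 rangeI)
  ultimately show ?thesis by (simp add: f_def)
qed

lemma summable_lattice_weight: "lattice_weight summable_on UNIV"
proof -
  obtain s where s: "((\<lambda>n :: int. inverse (1 + of_int n ^ 2) :: real) has_sum s) UNIV"
    using summable_inverse_one_plus_square_int by (auto simp: summable_on_def)
  have "lattice_weight summable_on UNIV \<times> UNIV"
  proof (rule summable_on_SigmaI)
    fix c :: int
    show "((\<lambda>d. lattice_weight (c, d)) has_sum (inverse (1 + of_int c ^ 2) * s)) UNIV"
      unfolding lattice_weight_def using has_sum_cmult_right[OF s] by simp
  qed (auto intro!: summable_on_cmult_left summable_inverse_one_plus_square_int lattice_weight_nonneg)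
  thus ?thesis by simp
qed

text \<open>\<open>N\<^sup>2\<close> is comparable to \<open>C\<^sup>2 + D\<^sup>2\<close>, with a
  constant depending only on \<open>B\<close>. Since coprimality excludes (0, 0), this sum is at
  least 1, and then the product \<open>(1 + C\<^sup>2) * (1 + D\<^sup>2)\<close> is at most three
  times its square.\<close>

lemma inverse_norm_linear_power4_le:
  assumes "Im z > 1 / 4" "\<bar>Re z\<bar> \<le> B" "coprime c d"
  shows "inverse (norm (of_int c * z + of_int d) ^ 4) \<le> 3 * (16 * (2 * B\<^sup>2 + 1))\<^sup>2 * lattice_weight (c, d)"
proof -
  define x y C D where "x = Re z" "y = Im z" "C = real_of_int c" "D = real_of_int d"
  define N where "N = norm (of_int c * z + of_int d)"
  define K where "K = 16 * (2 * B\<^sup>2 + 1)"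
  have N2: "N\<^sup>2 = (C * x + D)\<^sup>2 + C\<^sup>2 * y\<^sup>2"
    by (simp add: N_def cmod_power2 x_y_C_D_def power_mult_distrib)
  have Npos: "N > 0" using norm_linear_ge[OF assms(1,3)] unfolding N_def by linarith
  have "x\<^sup>2 \<le> B\<^sup>2" using assms(2) by (simp add: x_y_C_D_def abs_le_square_iff[symmetric])
  hence "C\<^sup>2 * x\<^sup>2 \<le> C\<^sup>2 * B\<^sup>2" by (intro mult_left_mono) auto
  \<comment> \<open>The difference of the two sides is exactly the square of
    \<open>2 * C * x + D\<close>.\<close>
  moreover have "D\<^sup>2 \<le> 2 * (C * x + D)\<^sup>2 + 2 * (C\<^sup>2 * x\<^sup>2)"
    using zero_le_power2[of "2 * C * x + D"] by (simp add: power2_eq_square algebra_simps)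
  ultimately have "C\<^sup>2 + D\<^sup>2 \<le> 2 * (C * x + D)\<^sup>2 + C\<^sup>2 * (2 * B\<^sup>2 + 1)"
    by (simp add: algebra_simps)
  moreover have "C\<^sup>2 * (2 * B\<^sup>2 + 1) \<le> (16 * (C\<^sup>2 * y\<^sup>2)) * (2 * B\<^sup>2 + 1)"
  proof (intro mult_right_mono)
    have "(1/4)\<^sup>2 \<le> y\<^sup>2" using assms(1) by (intro power_mono) (auto simp: x_y_C_D_def)
    hence "C\<^sup>2 * (1/4)\<^sup>2 \<le> C\<^sup>2 * y\<^sup>2" by (intro mult_left_mono) auto
    thus "C\<^sup>2 \<le> 16 * (C\<^sup>2 * y\<^sup>2)" by (simp add: power2_eq_square)
  qed auto
  moreover have "2 * (C * x + D)\<^sup>2 \<le> K * (C * x + D)\<^sup>2"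
    by (intro mult_right_mono) (auto simp: K_def)
  moreover have "K * N\<^sup>2 = K * (C * x + D)\<^sup>2 + (16 * (C\<^sup>2 * y\<^sup>2)) * (2 * B\<^sup>2 + 1)"
    by (simp add: N2 K_def algebra_simps)
  ultimately have s: "C\<^sup>2 + D\<^sup>2 \<le> K * N\<^sup>2"
    by linarith
  define S where "S = C\<^sup>2 + D\<^sup>2"
  have "c \<noteq> 0 \<or> d \<noteq> 0" using assms(3) by auto
  hence "0 < c\<^sup>2 \<or> 0 < d\<^sup>2" by simp
  hence "1 \<le> c\<^sup>2 + d\<^sup>2" using zero_le_power2[of c] zero_le_power2[of d] by linarith
  hence S1: "1 \<le> S" unfolding S_def x_y_C_D_def by (metis of_int_1_le_iff of_int_add of_int_power)
  have "(1 + C\<^sup>2) * (1 + D\<^sup>2) = 1 + S + C\<^sup>2 * D\<^sup>2" by (simp add: S_def algebra_simps)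
  also have "C\<^sup>2 * D\<^sup>2 \<le> S * S" by (intro mult_mono) (auto simp: S_def)
  also have "1 + S + S * S \<le> 3 * S\<^sup>2"
  proof -
    have "S * 1 \<le> S * S" using S1 by (intro mult_left_mono) auto
    thus ?thesis using S1 unfolding power2_eq_square by linarith
  qed
  also have "3 * S\<^sup>2 \<le> 3 * (K * N\<^sup>2)\<^sup>2"
    using s S1 by (intro mult_left_mono power_mono) (auto simp: S_def)
  finally have "(1 + C\<^sup>2) * (1 + D\<^sup>2) \<le> 3 * K\<^sup>2 * N ^ 4"
    by (simp add: power_mult_distrib flip: power_mult)
  hence "inverse (N ^ 4) \<le> 3 * K\<^sup>2 * inverse ((1 + C\<^sup>2) * (1 + D\<^sup>2))"
    using Npos by (simp add: field_simps add_pos_nonneg)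
  thus ?thesis
    by (simp add: N_def K_def lattice_weight_def x_y_C_D_def)
qed

text \<open>The exponential factor is at most 1. Four of the \<open>k\<close> powers of
  \<open>N\<close> yield the summable weight, and the other \<open>k - 4\<close> cost at most 4
  each. The bound depends on \<open>z\<close> only through \<open>B\<close>, as the Weierstrass test
  requires.\<close>

lemma norm_poincare_term_le:
  assumes "Im z > 1 / 4" "\<bar>Re z\<bar> \<le> B" "coprime c d" "k \<ge> 4"
  shows "norm (poincare_term k m z (c, d)) \<le> 4 ^ k * (3 * (16 * (2 * B\<^sup>2 + 1))\<^sup>2) * lattice_weight (c, d)"
proof -
  define N where "N = norm (of_int c * z + of_int d)"
  have N: "N \<ge> 1 / 4" using norm_linear_ge[OF assms(1,3)] by (simp add: N_def)
  have "norm (poincare_term k m z (c, d)) \<le> 1 / N ^ k"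
    using assms N by (subst norm_poincare_term) (auto simp: N_def intro!: divide_right_mono)
  also have "\<dots> = inverse N ^ (k - 4) * inverse (N ^ 4)"
    using assms(4) N by (simp add: power_inverse field_simps flip: power_add)
  also have "\<dots> \<le> 4 ^ k * (3 * (16 * (2 * B\<^sup>2 + 1))\<^sup>2 * lattice_weight (c, d))"
  proof (intro mult_mono)
    have "inverse N \<le> 4" using N by (simp add: field_simps)
    hence "inverse N ^ (k - 4) \<le> 4 ^ (k - 4)" using N by (intro power_mono) auto
    also have "\<dots> \<le> 4 ^ k" by (intro power_increasing) auto
    finally show "inverse N ^ (k - 4) \<le> 4 ^ k" .
    show "inverse (N ^ 4) \<le> 3 * (16 * (2 * B\<^sup>2 + 1))\<^sup>2 * lattice_weight (c, d)"
      unfolding N_def using inverse_norm_linear_power4_le assms by blast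
  qed (use N in auto)
  finally show ?thesis by (simp add: mult_ac)
qed

lemma poincare_term_abs_summable:
  assumes "Im z > 1 / 4" "k \<ge> 4"
  shows "(\<lambda>cd. norm (poincare_term k m z cd)) summable_on {(c, d). coprime c d}"
proof (rule Infinite_Sum.abs_summable_on_comparison_test')
  show "(\<lambda>cd. 4 ^ k * (3 * (16 * (2 * (Re z)\<^sup>2 + 1))\<^sup>2) * lattice_weight cd) summable_on {(c, d). coprime c d}"
    using summable_on_subset[OF summable_lattice_weight] by (intro summable_on_cmult_right) auto
  show "norm (poincare_term k m z cd) \<le> 4 ^ k * (3 * (16 * (2 * (Re z)\<^sup>2 + 1))\<^sup>2) * lattice_weight cd"
    if "cd \<in> {(c, d). coprime c d}" for cd
    using that norm_poincare_term_le[of z "\<bar>Re z\<bar>" "fst cd" "snd cd" k m] assms by auto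
qed

section \<open>Periodicity, reality on the line, holomorphy and an upper bound\<close>

text \<open>Multiplying the matrix on the right by the translation by 1 turns its bottom row into
  \<open>(c, c + d)\<close>, which permutes the coprime pairs.\<close>

lemma poincare_series_plus_1:
  assumes "Im z > 0"
  shows "poincare_series k m (z + 1) = poincare_series k m z"
proof -
  have cop: "coprime c (c + d) \<longleftrightarrow> coprime c d" for c d :: int
    by (simp add: coprime_iff_gcd_eq_1)
  have cop': "coprime c (d - c) \<longleftrightarrow> coprime c d" for c d :: int
    using cop[of c "d - c"] by simp
  have "(\<Sum>\<^sub>\<infinity>cd\<in>{(c, d). coprime c d}. poincare_term k m (z + 1) cd) =
        (\<Sum>\<^sub>\<infinity>cd\<in>{(c, d). coprime c d}. poincare_term k m z cd)"
  proof (rule infsum_reindex_bij_witness[of _ "\<lambda>(c, d). (c, d - c)" "\<lambda>(c, d). (c, c + d)"])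
    fix cd :: "int \<times> int" assume "cd \<in> {(c, d). coprime c d}"
    then obtain c d where cd: "cd = (c, d)" "coprime c d" by auto
    obtain a b where ab: "top_row c d = (a, b)" by force
    have det: "a * d - b * c = 1" using top_row_det[OF cd(2) ab] .
    have det': "a * (c + d) - (a + b) * c = 1" using det by (simp add: algebra_simps)
    show "poincare_term k m z (case cd of (c, d) \<Rightarrow> (c, c + d)) = poincare_term k m (z + 1) cd"
      using assms unfolding cd split
      by (subst poincare_term_eq[OF _ det'], simp add: upper_half_plane_def,
          subst poincare_term_eq[OF _ det], simp add: upper_half_plane_def)
         (simp add: moebius_def algebra_simps)
  qed (auto simp: cop cop')
  thus ?thesis by (simp add: poincare_series_def)
qed

text \<open>On the line, \<open>cnj z = 1 - z\<close>, so conjugating the term of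
  \<open>(c, d)\<close> gives the term of \<open>(- c, c + d)\<close>, and this map is an involution
  of the coprime pairs. The series is thus real there, and sign changes produce zeros.\<close>

lemma cnj_poincare_series_half:
  assumes "Im z > 0" "Re z = 1 / 2"
  shows "cnj (poincare_series k m z) = poincare_series k m z"
proof -
  have cz: "cnj z = 1 - z" using assms by (simp add: complex_eq_iff)
  have "(\<Sum>\<^sub>\<infinity>cd\<in>{(c, d). coprime c d}. cnj (poincare_term k m z cd)) =
        (\<Sum>\<^sub>\<infinity>cd\<in>{(c, d). coprime c d}. poincare_term k m z cd)"
  proof (rule infsum_reindex_bij_witness[of _ "\<lambda>(c, d). (- c, c + d)" "\<lambda>(c, d). (- c, c + d)"])
    fix cd :: "int \<times> int" assume "cd \<in> {(c, d). coprime c d}"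
    then obtain c d where cd: "cd = (c, d)" "coprime c d" by auto
    obtain a b where ab: "top_row c d = (a, b)" by force
    have det: "a * d - b * c = 1" using top_row_det[OF cd(2) ab] .
    \<comment> \<open>The top row \<open>(a, - a - b)\<close> represents the map sending
      \<open>z\<close> to minus the conjugate of the original image; that minus sign is what
      conjugating the exponential requires.\<close>
    have det': "a * (c + d) - (- a - b) * (- c) = 1" using det by (simp add: algebra_simps)
    have "- cnj (moebius (of_int a) (of_int b) (of_int c) (of_int d) z) =
        moebius (of_int a) (of_int (- a - b)) (of_int (- c)) (of_int (c + d)) z"
      unfolding moebius_def complex_cnj_divide minus_divide_left
      by (rule arg_cong2[of _ _ _ _ "(/)"]) (simp_all add: cz algebra_simps)
    moreover have "cnj (exp (2 * of_real pi * \<i> * of_nat m * w)) = exp (2 * of_real pi * \<i> * of_nat m * (- cnj w))" for w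
      by (simp add: exp_cnj)
    moreover have "cnj (of_int c * z + of_int d) = of_int (- c) * z + of_int (c + d)"
      by (simp add: cz algebra_simps)
    ultimately show "poincare_term k m z (case cd of (c, d) \<Rightarrow> (- c, c + d)) = cnj (poincare_term k m z cd)"
      using assms unfolding cd split
      by (subst poincare_term_eq[OF _ det'], simp add: upper_half_plane_def,
          subst poincare_term_eq[OF _ det], simp add: upper_half_plane_def)
         (simp only: complex_cnj_divide complex_cnj_power)
  qed (auto simp: coprime_iff_gcd_eq_1 gcd_add1 gcd_add2 gcd.commute)
  thus ?thesis by (simp add: poincare_series_def flip: infsum_cnj)
qed

text \<open>On a closed disc inside the half plane the real parts are bounded, so one majorant
  serves all its points and the finite partial sums converge uniformly.\<close>

lemma poincare_series_holomorphic:
  assumes "k \<ge> 4"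
  shows "poincare_series k m holomorphic_on {z. Im z > 1 / 4}"
proof -
  define A where "A = {(c :: int, d :: int). coprime c d}"
  have "\<exists>r>0. (\<lambda>z. \<Sum>\<^sub>\<infinity>cd\<in>A. poincare_term k m z cd) holomorphic_on ball z r" if z: "Im z > 1 / 4" for z
  proof -
    have "open {z. Im z > 1 / 4}" by (rule open_halfspace_Im_gt)
    then obtain r where r: "r > 0" "cball z r \<subseteq> {z. Im z > 1 / 4}"
      using z by (meson mem_Collect_eq open_contains_cball)
    define B where "B = \<bar>Re z\<bar> + r"
    have B: "\<bar>Re w\<bar> \<le> B" if "w \<in> cball z r" for w
      using that abs_Re_le_cmod[of "w - z"] by (auto simp: B_def dist_norm norm_minus_commute)
    have ulim: "uniform_limit (cball z r) (\<lambda>X w. \<Sum>cd\<in>X. poincare_term k m w cd)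
        (\<lambda>w. \<Sum>\<^sub>\<infinity>cd\<in>A. poincare_term k m w cd) (finite_subsets_at_top A)"
    proof (intro Weierstrass_m_test_general)
      show "(\<lambda>cd. 4 ^ k * (3 * (16 * (2 * B\<^sup>2 + 1))\<^sup>2) * lattice_weight cd) summable_on A"
        by (intro summable_on_cmult_right summable_on_subset[OF summable_lattice_weight]) auto
      show "norm (poincare_term k m w cd) \<le> 4 ^ k * (3 * (16 * (2 * B\<^sup>2 + 1))\<^sup>2) * lattice_weight cd"
        if "cd \<in> A" "w \<in> cball z r" for cd w
        using that(1) norm_poincare_term_le[of w B "fst cd" "snd cd" k m] B[OF that(2)] subsetD[OF r(2) that(2)] assms
        by (auto simp: A_def)
    qed
    have hol: "(\<lambda>w. poincare_term k m w cd) holomorphic_on cball z r" if cd: "cd \<in> A" for cd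
    proof -
      obtain c d a b where c: "cd = (c, d)" "coprime c d" and ab: "top_row c d = (a, b)"
        using cd unfolding A_def by force
      have nz: "of_int c * w + of_int d \<noteq> 0" if "w \<in> cball z r" for w
        using norm_linear_ge[of w c d] that r(2) c(2) by fastforce
      thus ?thesis unfolding c poincare_term_def split ab moebius_def
        by (intro holomorphic_intros) auto
    qed
    show ?thesis
    proof (rule holomorphic_uniform_limit[OF _ ulim])
      show "\<forall>\<^sub>F X in finite_subsets_at_top A. continuous_on (cball z r) (\<lambda>w. \<Sum>cd\<in>X. poincare_term k m w cd) \<and>
          (\<lambda>w. \<Sum>cd\<in>X. poincare_term k m w cd) holomorphic_on ball z r"
      proof (rule eventually_finite_subsets_at_top_weakI)
        fix X assume "finite X" "X \<subseteq> A"
        hence "(\<lambda>w. \<Sum>cd\<in>X. poincare_term k m w cd) holomorphic_on cball z r"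
          using hol by (intro holomorphic_intros) auto
        thus "continuous_on (cball z r) (\<lambda>w. \<Sum>cd\<in>X. poincare_term k m w cd) \<and>
          (\<lambda>w. \<Sum>cd\<in>X. poincare_term k m w cd) holomorphic_on ball z r"
          using holomorphic_on_imp_continuous_on holomorphic_on_subset ball_subset_cball by blast
      qed
    qed (use r in auto)
  qed
  hence "(\<lambda>z. \<Sum>\<^sub>\<infinity>cd\<in>A. poincare_term k m z cd) analytic_on {z. Im z > 1 / 4}"
    unfolding analytic_on_def by auto
  thus ?thesis
    unfolding poincare_series_def[abs_def] A_def
    by (intro holomorphic_intros analytic_imp_holomorphic) auto
qed

definition lattice_const :: real where
  "lattice_const = infsum lattice_weight UNIV"

lemma lattice_const_nonneg: "lattice_const \<ge> 0"
  unfolding lattice_const_def by (intro infsum_nonneg lattice_weight_nonneg)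

lemma infsum_lattice_weight_le: "infsum lattice_weight A \<le> lattice_const"
  unfolding lattice_const_def
  by (intro infsum_mono_neutral summable_on_subset[OF summable_lattice_weight] summable_lattice_weight)
     (auto intro: lattice_weight_nonneg)

text \<open>Translation by an integer reduces to \<open>|Re w| \<le> 1\<close>, where the term bound
  applies with \<open>B = 1\<close>; then 3456 is half of 3 * 48^2. The result is uniform in
  \<open>z\<close> and \<open>m\<close>.\<close>

lemma norm_poincare_series_le:
  assumes "Im z > 1 / 4" "k \<ge> 4"
  shows "norm (poincare_series k m z) \<le> 4 ^ k * (3456 * lattice_const)"
proof -
  define A where "A = {(c :: int, d :: int). coprime c d}"
  define w where "w = z + of_int (- \<lfloor>Re z\<rfloor>)"
  have w: "Im w > 1 / 4" "\<bar>Re w\<bar> \<le> 1" using assms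
    by (auto simp: w_def) linarith+
  have "norm (poincare_series k m w) = 1 / 2 * norm (\<Sum>\<^sub>\<infinity>cd\<in>A. poincare_term k m w cd)"
    by (simp add: poincare_series_def A_def norm_mult)
  also have "norm (\<Sum>\<^sub>\<infinity>cd\<in>A. poincare_term k m w cd) \<le> (\<Sum>\<^sub>\<infinity>cd\<in>A. norm (poincare_term k m w cd))"
    unfolding A_def by (intro norm_infsum_bound poincare_term_abs_summable w assms)
  also have "\<dots> \<le> (\<Sum>\<^sub>\<infinity>cd\<in>A. 4 ^ k * (3 * (16 * (2 * 1\<^sup>2 + 1))\<^sup>2) * lattice_weight cd)"
  proof (rule infsum_mono)
    show "(\<lambda>cd. norm (poincare_term k m w cd)) summable_on A"
      unfolding A_def by (intro poincare_term_abs_summable w assms)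
    show "(\<lambda>cd. 4 ^ k * (3 * (16 * (2 * 1\<^sup>2 + 1))\<^sup>2) * lattice_weight cd) summable_on A"
      by (intro summable_on_cmult_right summable_on_subset[OF summable_lattice_weight]) auto
    show "norm (poincare_term k m w cd) \<le> 4 ^ k * (3 * (16 * (2 * 1\<^sup>2 + 1))\<^sup>2) * lattice_weight cd" if "cd \<in> A" for cd
      using that norm_poincare_term_le[of w 1 "fst cd" "snd cd" k m] w assms by (auto simp: A_def)
  qed
  also have "\<dots> = 4 ^ k * (3 * (16 * (2 * 1\<^sup>2 + 1))\<^sup>2) * infsum lattice_weight A"
    by (rule infsum_cmult_right') 
  also have "\<dots> \<le> 4 ^ k * (3 * (16 * (2 * 1\<^sup>2 + 1))\<^sup>2) * lattice_const"
    by (intro mult_left_mono infsum_lattice_weight_le) auto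
  finally have le: "norm (poincare_series k m w) \<le> 4 ^ k * (3456 * lattice_const)"
    by (simp add: mult_ac)
  have "poincare_series k m w = poincare_series k m z"
    unfolding w_def using assms by (intro periodic_of_int[where y = "1 / 4"] poincare_series_plus_1) auto
  thus ?thesis using le by simp
qed

subsection \<open>Asymptotics on the line\<close>

text \<open>The modulus of the term of \<open>(1, 0)\<close> at \<open>half_line t\<close>, where
  \<open>|z|^2 = 1 / 4 + t\<^sup>2\<close>.\<close>

definition amp :: "nat \<Rightarrow> nat \<Rightarrow> real \<Rightarrow> real" where
  "amp k m t = exp (- (2 * pi * m * t / (1 / 4 + t\<^sup>2))) / sqrt (1 / 4 + t\<^sup>2) ^ k"

text \<open>Minus the argument of the same term: the first summand comes from \<open>z ^ k\<close>,
  the second from the real part of \<open>- 1 / z\<close>.\<close>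

definition phase :: "nat \<Rightarrow> nat \<Rightarrow> real \<Rightarrow> real" where
  "phase k m t = k * arctan (2 * t) + pi * m / (1 / 4 + t\<^sup>2)"

abbreviation half_line :: "real \<Rightarrow> complex" where
  "half_line t \<equiv> 1 / 2 + of_real t * \<i>"

lemma amp_pos: "amp k m t > 0"
  by (simp add: amp_def add_pos_nonneg)

lemma norm_half_line: "norm (half_line t) = sqrt (1 / 4 + t\<^sup>2)"
  by (simp add: cmod_def power2_eq_square)

lemma half_line_polar: "half_line t = of_real (sqrt (1 / 4 + t\<^sup>2)) * cis (arctan (2 * t))"
proof -
  define q where "q = sqrt (1 + (2 * t)\<^sup>2)"
  have "1 / 4 + t\<^sup>2 = (1 + (2 * t)\<^sup>2) / 4" by (simp add: power2_eq_square field_simps)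
  hence eq: "sqrt (1 / 4 + t\<^sup>2) = q / 2"
    by (simp only: real_sqrt_divide real_sqrt_four q_def)
  have "q > 0" by (simp add: q_def add_pos_nonneg)
  moreover have "cos (arctan (2 * t)) = 1 / q" "sin (arctan (2 * t)) = 2 * t / q"
    by (simp_all only: cos_arctan sin_arctan q_def)
  ultimately show ?thesis
    unfolding eq by (simp add: complex_eq_iff)
qed

lemma poincare_term_1_0:
  assumes "t > 0"
  shows "poincare_term k m (half_line t) (1, 0) = of_real (amp k m t) * cis (- phase k m t)"
proof -
  define z where "z = half_line t"
  define R where "R = 1 / 4 + t\<^sup>2"
  have R: "R > 0" by (simp add: R_def add_pos_nonneg)
  \<comment> \<open>The top row \<open>(0, -1)\<close> is used, so that the matrix acts by
    \<open>- 1 / z\<close>.\<close>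
  have det: "(0::int) * 0 - (- 1) * 1 = 1" by simp
  have "poincare_term k m z (1, 0) = exp (2 * of_real pi * \<i> * of_nat m * (- 1 / z)) / z ^ k"
    using assms by (subst poincare_term_eq[OF _ det]) (auto simp: upper_half_plane_def z_def moebius_def)
  also have "- 1 / z = - cnj z / of_real R"
    by (subst complex_div_cnj) (simp add: z_def norm_half_line R_def)
  also have "2 * of_real pi * \<i> * of_nat m * (- cnj z / of_real R) =
      of_real (- (2 * pi * m * t / R)) + \<i> * of_real (- (pi * m / R))"
    using R by (simp add: complex_eq_iff z_def field_simps)
  also have "exp \<dots> = of_real (exp (- (2 * pi * m * t / R))) * cis (- (pi * m / R))"
    by (simp only: exp_add exp_of_real cis_conv_exp)
  also have "z ^ k = of_real (sqrt R ^ k) * cis (k * arctan (2 * t))"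
    unfolding z_def half_line_polar R_def by (simp add: power_mult_distrib Complex.DeMoivre)
  also have "of_real (exp (- (2 * pi * m * t / R))) * cis (- (pi * m / R)) / (of_real (sqrt R ^ k) * cis (k * arctan (2 * t))) =
      of_real (amp k m t) * (cis (- (pi * m / R)) / cis (k * arctan (2 * t)))"
    by (simp add: amp_def R_def)
  also have "cis (- (pi * m / R)) / cis (k * arctan (2 * t)) = cis (- phase k m t)"
  proof -
    have "- (pi * m / R) - k * arctan (2 * t) = - phase k m t" by (simp add: phase_def R_def)
    thus ?thesis by (simp only: cis_divide)
  qed
  finally show ?thesis by (simp add: z_def)
qed

lemma poincare_term_uminus:
  assumes "Im z > 0" "even k" "coprime c d"
  shows "poincare_term k m z (- c, - d) = poincare_term k m z (c, d)"
proof -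
  obtain a b where ab: "top_row c d = (a, b)" by force
  have det: "a * d - b * c = 1" using top_row_det[OF assms(3) ab] .
  hence det': "(- a) * (- d) - (- b) * (- c) = 1" by simp
  have z: "z \<in> upper_half_plane" using assms by (simp add: upper_half_plane_def)
  have *: "of_int (- c) * z + of_int (- d) = - (of_int c * z + of_int d)" for c d by simp
  show ?thesis
    unfolding poincare_term_eq[OF z det] poincare_term_eq[OF z det']
    by (simp only: moebius_def * minus_divide_divide power_minus_even[OF assms(2)])
qed

lemma poincare_term_0_1:
  assumes "Im z > 0"
  shows "poincare_term k m z (0, 1) = exp (2 * of_real pi * \<i> * of_nat m * z)"
proof -
  have det: "(1::int) * 1 - 0 * 0 = 1" by simp
  show ?thesis
    using assms by (subst poincare_term_eq[OF _ det]) (auto simp: upper_half_plane_def moebius_def)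
qed

text \<open>On the line, \<open>z - 1\<close> is minus the conjugate of \<open>z\<close>. The two
  dominant terms are therefore conjugate, and their sum is twice a real part, which produces the
  cosine.\<close>

lemma poincare_term_1_minus_1:
  assumes "Im z > 0" "Re z = 1 / 2" "even k"
  shows "poincare_term k m z (1, - 1) = cnj (poincare_term k m z (1, 0))"
proof -
  have det: "(0::int) * 0 - (- 1) * 1 = 1" "(0::int) * (- 1) - (- 1) * 1 = 1" by simp_all
  have z: "z \<in> upper_half_plane" using assms by (simp add: upper_half_plane_def)
  have "z - 1 = - cnj z" using assms by (simp add: complex_eq_iff)
  thus ?thesis
    unfolding poincare_term_eq[OF z det(1)] poincare_term_eq[OF z det(2)]
    using assms(3) by (simp add: moebius_def exp_cnj)
qed

text \<open>Besides the four dominant pairs this contains \<open>(0, 1)\<close> and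
  \<open>(0, -1)\<close>: they have \<open>|cz + d| = 1\<close>, so the comparison valid for
  \<open>|cz + d| \<ge> |z|\<close> does not reach them and they are estimated separately.\<close>

definition main_pairs :: "(int \<times> int) set" where
  "main_pairs = {(0, 1), (0, -1), (1, 0), (-1, 0), (1, -1), (-1, 1)}"

lemma sum_main_pairs:
  assumes "t > 0" "even k"
  shows "(\<Sum>cd\<in>main_pairs. poincare_term k m (half_line t) cd) =
    2 * exp (2 * of_real pi * \<i> * of_nat m * half_line t) + of_real (4 * amp k m t * cos (phase k m t))"
proof -
  define z where "z = half_line t"
  have z: "Im z > 0" "Re z = 1 / 2" using assms by (simp_all add: z_def)
  have "(\<Sum>cd\<in>main_pairs. poincare_term k m z cd) =
     2 * (poincare_term k m z (0, 1) + (poincare_term k m z (1, 0) + cnj (poincare_term k m z (1, 0))))"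
    using poincare_term_uminus[of z k 0 1 m] poincare_term_uminus[of z k 1 0 m] poincare_term_uminus[of z k 1 "- 1" m]
      poincare_term_1_minus_1[of z k m] z assms by (simp add: main_pairs_def)
  also have "\<dots> = 2 * (poincare_term k m z (0, 1) + of_real (2 * Re (poincare_term k m z (1, 0))))"
    by (subst complex_add_cnj) simp
  also have "Re (poincare_term k m z (1, 0)) = amp k m t * cos (phase k m t)"
    using assms by (simp add: z_def poincare_term_1_0)
  finally show ?thesis using z by (simp add: poincare_term_0_1 z_def)
qed

text \<open>The squared norm is \<open>(c + 2d)^2 / 4 + c^2 t^2\<close>. For
  \<open>c = \<plusminus>1\<close> the odd number \<open>c + 2d\<close> is not
  \<open>\<plusminus>1\<close>, so it contributes at least 9/4 = 1/4 + 2; for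
  \<open>|c| \<ge> 2\<close> the second summand alone suffices. The gap of 2 is the source of the
  exponential gain.\<close>

lemma norm_linear_ge_off_main_pairs:
  assumes "t \<ge> 1" "coprime c d" "(c, d) \<notin> main_pairs"
  shows "norm (of_int c * half_line t + of_int d) \<ge> sqrt (1 / 4 + t\<^sup>2 + 2)"
proof -
  have N2: "norm (of_int c * half_line t + of_int d) ^ 2 = (of_int (c + 2 * d))\<^sup>2 / 4 + (of_int c)\<^sup>2 * t\<^sup>2"
  proof -
    have "Re (of_int c * half_line t + of_int d) = of_int (c + 2 * d) / 2"
         "Im (of_int c * half_line t + of_int d) = of_int c * t" by simp_all
    thus ?thesis by (simp only: cmod_power2 power_divide power_mult_distrib) simp
  qed
  have t2: "1 \<le> t\<^sup>2" using assms(1) by simp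
  have "1 / 4 + t\<^sup>2 + 2 \<le> (of_int (c + 2 * d))\<^sup>2 / 4 + (of_int c)\<^sup>2 * t\<^sup>2"
  proof (cases "\<bar>c\<bar> \<ge> 2")
    case True
    hence "2\<^sup>2 \<le> c\<^sup>2" by (metis abs_numeral abs_le_square_iff)
    hence "of_int 4 \<le> (of_int (c\<^sup>2) :: real)" by (subst of_int_le_iff) simp
    hence "4 \<le> (of_int c :: real)\<^sup>2" by simp
    hence "4 * t\<^sup>2 \<le> (of_int c)\<^sup>2 * t\<^sup>2" by (intro mult_right_mono) auto
    thus ?thesis using t2 zero_le_power2[of "of_int (c + 2 * d) :: real"] by linarith
  next
    case False
    hence "c = 0 \<or> c = 1 \<or> c = - 1" by linarith
    moreover have "c \<noteq> 0"
    proof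
      assume "c = 0"
      hence "\<bar>d\<bar> = 1" using assms(2) by simp
      thus False using assms(3) \<open>c = 0\<close> by (auto simp: main_pairs_def)
    qed
    ultimately have c: "c = 1 \<or> c = - 1" by blast
    hence "\<bar>c + 2 * d\<bar> \<ge> 3" using assms(3) by (auto simp: main_pairs_def)
    hence "3\<^sup>2 \<le> (c + 2 * d)\<^sup>2" by (metis abs_numeral abs_le_square_iff)
    hence "of_int 9 \<le> (of_int ((c + 2 * d)\<^sup>2) :: real)" by (subst of_int_le_iff) simp
    hence "9 \<le> (of_int (c + 2 * d) :: real)\<^sup>2" by simp
    moreover have "(of_int c :: real)\<^sup>2 = 1" using c by auto
    ultimately show ?thesis by simp
  qed
  thus ?thesis unfolding N2[symmetric] by (rule real_le_lsqrt[rotated]) auto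
qed

text \<open>A term with \<open>|cz + d| = r / v\<close> is smaller than the dominant ones by the factor
  \<open>v\<^sup>k exp (x (1 - v\<^sup>2))\<close>, and \<open>1 - v\<^sup>2 \<le> - 2 ln v\<close>.\<close>

lemma norm_poincare_term_le_amp:
  assumes "t > 0" "coprime c d"
    and x: "2 * pi * m * t / (1 / 4 + t\<^sup>2) \<le> l / 2"
    and N: "sqrt (1 / 4 + t\<^sup>2) \<le> norm (of_int c * half_line t + of_int d)"
  shows "norm (poincare_term (2 * l) m (half_line t) (c, d)) \<le>
    amp (2 * l) m t * (sqrt (1 / 4 + t\<^sup>2) / norm (of_int c * half_line t + of_int d)) ^ l"
proof -
  define r where "r = sqrt (1 / 4 + t\<^sup>2)"
  define N where "N = norm (of_int c * half_line t + of_int d)"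
  define v where "v = r / N"
  define x where "x = 2 * pi * m * t / (1 / 4 + t\<^sup>2)"
  have r2: "1 / 4 + t\<^sup>2 = r\<^sup>2" by (simp add: r_def)
  have r: "r > 0" by (simp add: r_def add_pos_nonneg)
  have Nr: "N \<ge> r" using assms by (simp add: N_def r_def)
  have Npos: "N > 0" using r Nr by linarith
  have v: "v > 0" "v \<le> 1" using r Nr Npos by (auto simp: v_def)
  have x0: "x \<ge> 0" using assms(1) by (auto simp: x_def intro!: divide_nonneg_nonneg)
  have "x * (1 - v\<^sup>2) \<le> x * (- 2 * ln v)"
  proof (intro mult_left_mono x0)
    have "ln (v\<^sup>2) \<le> v\<^sup>2 - 1" using v by (intro ln_le_minus_one) auto
    thus "1 - v\<^sup>2 \<le> - 2 * ln v" using v by (simp add: ln_realpow)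
  qed
  \<comment> \<open>Since \<open>x\<close> is at most \<open>l / 2\<close>, the exponential costs at
    most \<open>v\<close> to the power \<open>- l\<close>, and half of the decay
    \<open>v ^ (2 * l)\<close> survives.\<close>
  also have "\<dots> \<le> (l / 2) * (- 2 * ln v)"
    using v x by (intro mult_right_mono) (auto simp: x_def)
  finally have "exp (x * (1 - v\<^sup>2)) \<le> exp (- (l * ln v))" by simp
  also have "\<dots> = inverse (v ^ l)"
    using v by (simp add: exp_minus exp_of_nat_mult)
  finally have ex: "exp (x * (1 - v\<^sup>2)) \<le> inverse (v ^ l)" .
  have "norm (poincare_term (2 * l) m (half_line t) (c, d)) = exp (- (2 * pi * m * t / N\<^sup>2)) / N ^ (2 * l)"
    using assms(1,2) by (subst norm_poincare_term) (auto simp: N_def)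
  also have "2 * pi * m * t / N\<^sup>2 = x * v\<^sup>2"
    using r Npos by (simp add: x_def r2 v_def power_divide)
  also have "exp (- (x * v\<^sup>2)) = exp (- x) * exp (x * (1 - v\<^sup>2))"
    by (simp add: algebra_simps flip: exp_add)
  also have "\<dots> / N ^ (2 * l) \<le> exp (- x) * inverse (v ^ l) / N ^ (2 * l)"
    using ex Npos by (intro divide_right_mono mult_left_mono) auto
  also have "\<dots> = exp (- x) / r ^ (2 * l) * v ^ l"
  proof -
    have "n ^ (2 * l) = n ^ l * n ^ l" for n :: real by (simp add: mult_2 power_add)
    thus ?thesis using r Npos by (simp add: v_def field_simps)
  qed
  finally show ?thesis by (simp add: amp_def x_def r_def v_def N_def)
qed

text \<open>Each remaining term is smaller than the amplitude by the factor
  \<open>(s / N) ^ l\<close>. Four of these factors pay for the convergence of the sum and the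
  others give geometric decay. Replacing \<open>|z|\<close> by the upper bound \<open>\<rho>\<close>
  makes the rate independent of \<open>t\<close>.\<close>

lemma poincare_series_approx:
  assumes t: "t \<ge> 1" and l: "l \<ge> 4" and x: "2 * pi * m * t / (1 / 4 + t\<^sup>2) \<le> l / 2"
    and r: "sqrt (1 / 4 + t\<^sup>2) \<le> \<rho>"
  shows "norm (poincare_series (2 * l) m (half_line t) - of_real (2 * amp (2 * l) m t * cos (phase (2 * l) m t))) \<le>
    exp (- 2 * pi * m * t) + amp (2 * l) m t * (864 * lattice_const * \<rho> ^ 4 * (\<rho> / sqrt (\<rho>\<^sup>2 + 2)) ^ (l - 4))"
proof -
  define z where "z = half_line t"
  define A where "A = {(c :: int, d :: int). coprime c d}"
  define s where "s = sqrt (1 / 4 + t\<^sup>2)"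
  define Q where "Q = \<rho> / sqrt (\<rho>\<^sup>2 + 2)"
  define C where "C = amp (2 * l) m t * (Q ^ (l - 4) * (\<rho> ^ 4 * 1728))"
  have s2: "s\<^sup>2 = 1 / 4 + t\<^sup>2" by (simp add: s_def)
  have s: "s > 0" "s \<le> \<rho>" using r by (simp_all add: s_def add_pos_nonneg)
  have z: "Im z > 1 / 4" "\<bar>Re z\<bar> \<le> 1 / 2" using t by (auto simp: z_def)
  have sub: "main_pairs \<subseteq> A" "finite main_pairs" by (auto simp: main_pairs_def A_def)
  have sum': "(\<lambda>cd. norm (poincare_term (2 * l) m z cd)) summable_on A"
    unfolding A_def using z l by (intro poincare_term_abs_summable) auto
  have sum1: "(\<lambda>cd. norm (poincare_term (2 * l) m z cd)) summable_on (A - main_pairs)"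
    by (rule summable_on_subset[OF sum']) auto
  have sum: "poincare_term (2 * l) m z summable_on A"
    by (rule abs_summable_summable[OF sum'])
  have "(\<Sum>\<^sub>\<infinity>cd\<in>A - main_pairs. poincare_term (2 * l) m z cd) =
      (\<Sum>\<^sub>\<infinity>cd\<in>A. poincare_term (2 * l) m z cd) - (\<Sum>cd\<in>main_pairs. poincare_term (2 * l) m z cd)"
    using sub sum by (subst infsum_Diff) auto
  hence split: "poincare_series (2 * l) m z - of_real (2 * amp (2 * l) m t * cos (phase (2 * l) m t)) =
     exp (2 * of_real pi * \<i> * of_nat m * z) + 1 / 2 * (\<Sum>\<^sub>\<infinity>cd\<in>A - main_pairs. poincare_term (2 * l) m z cd)"
    using sum_main_pairs[of t "2 * l" m] t
    by (simp add: poincare_series_def A_def z_def algebra_simps)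
  \<comment> \<open>The function \<open>s / sqrt (s\<^sup>2 + 2)\<close> increases with
    \<open>s\<close>; the inequality is checked after clearing denominators.\<close>
  have Q: "s / sqrt (s\<^sup>2 + 2) \<le> Q"
  proof -
    have "s * sqrt (\<rho>\<^sup>2 + 2) = sqrt (s\<^sup>2 * \<rho>\<^sup>2 + 2 * s\<^sup>2)"
      using s by (subst real_sqrt_unique[of "s * sqrt (\<rho>\<^sup>2 + 2)"]) (auto simp: power_mult_distrib algebra_simps)
    also have "\<dots> \<le> sqrt (s\<^sup>2 * \<rho>\<^sup>2 + 2 * \<rho>\<^sup>2)"
      using s by (simp add: power_mono)
    also have "\<dots> = \<rho> * sqrt (s\<^sup>2 + 2)"
      using s by (subst real_sqrt_unique[of "\<rho> * sqrt (s\<^sup>2 + 2)"]) (auto simp: power_mult_distrib algebra_simps)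
    finally have le: "s * sqrt (\<rho>\<^sup>2 + 2) \<le> \<rho> * sqrt (s\<^sup>2 + 2)" .
    have pos: "sqrt (\<rho>\<^sup>2 + 2) > 0" "sqrt (s\<^sup>2 + 2) > 0" by (simp_all add: add_nonneg_pos)
    from mult_imp_le_div_pos[OF pos(1) le] show ?thesis
      by (intro mult_imp_div_pos_le pos) (simp add: Q_def)
  qed
  have term_le: "norm (poincare_term (2 * l) m z cd) \<le> C * lattice_weight cd" if cdA: "cd \<in> A - main_pairs" for cd
  proof -
    obtain c d where cd: "cd = (c, d)" "coprime c d" "(c, d) \<notin> main_pairs"
      using cdA by (cases cd) (auto simp: A_def)
    define N where "N = norm (of_int c * z + of_int d)"
    have N2: "N \<ge> sqrt (s\<^sup>2 + 2)"
      using norm_linear_ge_off_main_pairs[OF t cd(2,3)] by (simp add: N_def z_def s2)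
    moreover have "sqrt (s\<^sup>2) \<le> sqrt (s\<^sup>2 + 2)" by (subst real_sqrt_le_iff) simp
    ultimately have N: "N \<ge> s" using s by simp
    have "s / N \<le> s / sqrt (s\<^sup>2 + 2)"
      using s N2 N by (intro divide_left_mono) (auto simp: add_pos_nonneg intro!: mult_pos_pos)
    hence sN: "s / N \<le> Q" using Q by linarith
    have "norm (poincare_term (2 * l) m z cd) \<le> amp (2 * l) m t * (s / N) ^ l"
      using norm_poincare_term_le_amp[of t c d m l] t cd(2) x N by (simp add: cd z_def N_def s_def)
    also have "(s / N) ^ l = (s / N) ^ (l - 4) * (s ^ 4 * inverse (N ^ 4))"
      using l by (simp add: power_divide field_simps flip: power_add)
    also have "\<dots> \<le> Q ^ (l - 4) * (\<rho> ^ 4 * (1728 * lattice_weight (c, d)))"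
    proof (intro mult_mono power_mono sN)
      have "inverse (N ^ 4) \<le> 3 * (16 * (2 * (1 / 2)\<^sup>2 + 1))\<^sup>2 * lattice_weight (c, d)"
        unfolding N_def using z cd by (intro inverse_norm_linear_power4_le) auto
      also have "3 * (16 * (2 * (1 / 2)\<^sup>2 + 1))\<^sup>2 = (1728 :: real)" by (simp add: power2_eq_square)
      finally show "inverse (N ^ 4) \<le> 1728 * lattice_weight (c, d)" .
    qed (use s N in \<open>auto simp: Q_def lattice_weight_nonneg\<close>)
    finally show ?thesis
      using amp_pos[of "2 * l" m t] by (simp add: C_def cd mult_ac)
  qed
  have "norm (\<Sum>\<^sub>\<infinity>cd\<in>A - main_pairs. poincare_term (2 * l) m z cd) \<le> (\<Sum>\<^sub>\<infinity>cd\<in>A - main_pairs. norm (poincare_term (2 * l) m z cd))"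
    by (intro norm_infsum_bound sum1)
  also have "\<dots> \<le> (\<Sum>\<^sub>\<infinity>cd\<in>A - main_pairs. C * lattice_weight cd)"
    by (intro infsum_mono sum1 term_le summable_on_cmult_right summable_on_subset[OF summable_lattice_weight]) auto
  also have "\<dots> = C * infsum lattice_weight (A - main_pairs)"
    by (rule infsum_cmult_right')
  also have "\<dots> \<le> C * lattice_const"
    using s amp_pos[of "2 * l" m t] by (intro mult_left_mono infsum_lattice_weight_le) (auto simp: C_def Q_def less_imp_le)
  finally have rest: "norm (\<Sum>\<^sub>\<infinity>cd\<in>A - main_pairs. poincare_term (2 * l) m z cd) \<le> C * lattice_const" .
  have "Im z = t" by (simp add: z_def)
  hence "norm (exp (2 * of_real pi * \<i> * of_nat m * z) + 1 / 2 * (\<Sum>\<^sub>\<infinity>cd\<in>A - main_pairs. poincare_term (2 * l) m z cd))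
      \<le> exp (- 2 * pi * m * t) + 1 / 2 * (C * lattice_const)"
    using rest by (intro norm_triangle_le) (simp add: norm_mult norm_exp_eq_Re)
  also have "1 / 2 * (C * lattice_const) = amp (2 * l) m t * (864 * lattice_const * \<rho> ^ 4 * Q ^ (l - 4))"
    by (simp add: C_def)
  finally show ?thesis unfolding z_def Q_def split[unfolded z_def] .
qed

section \<open>Zeros from sign changes\<close>

text \<open>Where \<open>\<theta>\<close> equals \<open>j * pi\<close> the cosine is
  \<open>\<plusminus>1\<close>, so an error below the amplitude leaves \<open>f\<close> the sign of
  (-1)^j. Each pair of consecutive such points encloses a zero.\<close>

lemma card_zeros_oscillating:
  fixes f a \<theta> :: "real \<Rightarrow> real"
  assumes "x \<le> y" and cont: "continuous_on {x..y} f" "continuous_on {x..y} \<theta>"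
    and mono: "\<And>s t. x \<le> s \<Longrightarrow> s < t \<Longrightarrow> t \<le> y \<Longrightarrow> \<theta> s < \<theta> t"
    and close: "\<And>t. x \<le> t \<Longrightarrow> t \<le> y \<Longrightarrow> \<bar>f t - a t * cos (\<theta> t)\<bar> < a t"
  obtains Z where "finite Z" "Z \<subseteq> {x..y}" "\<And>t. t \<in> Z \<Longrightarrow> f t = 0" "real (card Z) \<ge> (\<theta> y - \<theta> x) / pi - 2"
proof -
  define n0 n1 where "n0 = \<lceil>\<theta> x / pi\<rceil>" and "n1 = \<lfloor>\<theta> y / pi\<rfloor>"
  have hit: "\<exists>s. x \<le> s \<and> s \<le> y \<and> \<theta> s = of_int j * pi" if "n0 \<le> j" "j \<le> n1" for j
  proof -
    have "\<theta> x / pi \<le> of_int j" "of_int j \<le> \<theta> y / pi"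
      using that unfolding n0_def n1_def by linarith+
    hence "\<theta> x \<le> of_int j * pi" "of_int j * pi \<le> \<theta> y" by (auto simp: field_simps)
    thus ?thesis using IVT'[of \<theta> x "of_int j * pi" y] assms(1) cont(2) by blast
  qed
  have "\<exists>t. x \<le> t \<and> t \<le> y \<and> f t = 0 \<and> of_int j * pi < \<theta> t \<and> \<theta> t < of_int (j + 1) * pi"
    if j: "j \<in> {n0..<n1}" for j
  proof -
    obtain s1 where s1: "x \<le> s1" "s1 \<le> y" "\<theta> s1 = of_int j * pi" using hit[of j] j by auto
    obtain s2 where s2: "x \<le> s2" "s2 \<le> y" "\<theta> s2 = of_int (j + 1) * pi" using hit[of "j + 1"] j by auto
    have "\<theta> s1 < \<theta> s2" using s1 s2 by simp
    hence less: "s1 < s2" using mono[of s2 s1] s1 s2 by (cases s1 s2 rule: linorder_cases) auto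
    have cos: "cos (of_int i * pi) = (if even i then 1 else - 1)" for i :: int
      using cos_npi_int[of i] by (simp add: mult.commute)
    have sgn1: "if even j then f s1 > 0 \<and> f s2 < 0 else f s1 < 0 \<and> f s2 > 0"
      using close[of s1] close[of s2] s1 s2 cos[of j] cos[of "j + 1"] by (auto split: if_splits)
    have cont': "continuous_on {s1..s2} f"
      using s1 s2 by (intro continuous_on_subset[OF cont(1)]) auto
    obtain t where t: "s1 \<le> t" "t \<le> s2" "f t = 0"
      using IVT'[of f s1 0 s2] IVT2'[of f s2 0 s1] cont' less sgn1 by (auto split: if_splits)
    \<comment> \<open>Strictness matters: zeros from neighbouring intervals must not coincide at a
      common endpoint.\<close>
    hence "t \<noteq> s1" "t \<noteq> s2" using sgn1 by (auto split: if_splits)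
    hence "s1 < t" "t < s2" using t by auto
    hence "\<theta> s1 < \<theta> t" "\<theta> t < \<theta> s2" using mono[of s1 t] mono[of t s2] s1 s2 by auto
    thus ?thesis using t s1 s2 by (intro exI[of _ t]) auto
  qed
  then obtain g where g: "\<And>j. j \<in> {n0..<n1} \<Longrightarrow> x \<le> g j \<and> g j \<le> y \<and> f (g j) = 0 \<and>
      of_int j * pi < \<theta> (g j) \<and> \<theta> (g j) < of_int (j + 1) * pi"
    by metis
  have "inj_on g {n0..<n1}"
  proof (rule inj_on_inverseI[where g = "\<lambda>t. \<lfloor>\<theta> t / pi\<rfloor>"])
    fix j assume "j \<in> {n0..<n1}"
    from g[OF this] show "\<lfloor>\<theta> (g j) / pi\<rfloor> = j"
      by (intro floor_unique) (auto simp: field_simps)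
  qed
  hence "card (g ` {n0..<n1}) = nat (n1 - n0)" by (simp add: card_image)
  \<comment> \<open>Rounding loses less than 1 at each end, and truncation by \<open>nat\<close> can
    only increase the value.\<close>
  moreover have "real (nat (n1 - n0)) \<ge> (\<theta> y - \<theta> x) / pi - 2"
    unfolding n0_def n1_def diff_divide_distrib by linarith
  ultimately show ?thesis
    using g by (intro that[of "g ` {n0..<n1}"]) auto
qed

subsection \<open>Zeros in the fundamental domain\<close>

text \<open>The half-open range of real parts makes the nome injective on the domain, and the height
  puts its image in a small disc.\<close>

lemma fundamental_domainD:
  assumes "z \<in> fundamental_domain"
  shows "- 1 / 2 < Re z" "Re z \<le> 1 / 2" "sqrt 3 / 2 \<le> Im z"
proof -
  have "- 1 / 2 < Re z \<and> Re z \<le> 1 / 2 \<and> sqrt 3 / 2 \<le> Im z"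
    using assms unfolding fundamental_domain_def
  proof (elim UnE CollectE conjE)
    assume z: "z \<in> upper_half_plane" "1 < norm z" "Re z \<in> {- 1 / 2<..1 / 2}"
    hence "\<bar>Re z\<bar> \<le> 1 / 2" by auto
    hence "(Re z)\<^sup>2 \<le> (1 / 2)\<^sup>2" by (metis abs_le_square_iff abs_of_nonneg zero_le_divide_1_iff zero_le_numeral)
    moreover have "1 < (norm z)\<^sup>2" using z(2) by simp
    ultimately have "3 / 4 \<le> (Im z)\<^sup>2" unfolding cmod_power2 by (simp add: power2_eq_square)
    hence "sqrt (3 / 4) \<le> Im z" using z(1) by (intro real_le_lsqrt) (auto simp: upper_half_plane_def)
    thus ?thesis using z(3) by (simp add: real_sqrt_divide)
  next
    assume z: "z \<in> upper_half_plane" "norm z = 1" "Arg z \<in> {pi / 3..pi / 2}"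
    hence "z \<noteq> 0" by auto
    hence "cis (Arg z) = z" using z(2) cis_Arg[of z] by (simp add: sgn_div_norm)
    hence ReIm: "Re z = cos (Arg z)" "Im z = sin (Arg z)" by (metis cis.sel)+
    have "cos (Arg z) \<le> cos (pi / 3)" "cos (pi / 2) \<le> cos (Arg z)"
      using z(3) by (intro cos_monotone_0_pi_le; simp)+
    moreover have "sin (pi / 3) \<le> sin (Arg z)"
      using z(3) by (intro sin_monotone_2pi_le) auto
    ultimately show ?thesis by (simp add: ReIm cos_60 sin_60)
  qed
  thus "- 1 / 2 < Re z" "Re z \<le> 1 / 2" "sqrt 3 / 2 \<le> Im z" by auto
qed

text \<open>The lowest point of the line is the corner of argument pi / 3, which lies on the
  included arc; all other points lie outside the unit circle.\<close>

lemma L_rho_subset_fundamental_domain: "L_rho \<subseteq> fundamental_domain"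
proof
  fix z assume "z \<in> L_rho"
  then obtain t where t: "z = half_line t" "t \<ge> sqrt 3 / 2" by (auto simp: L_rho_def)
  have "sqrt 3 > 0" by simp
  hence "t > 0" using t(2) by linarith
  hence z: "z \<in> upper_half_plane" by (simp add: t upper_half_plane_def)
  show "z \<in> fundamental_domain"
  proof (cases "t = sqrt 3 / 2")
    case True
    hence "z = cis (pi / 3)" by (simp add: t complex_eq_iff cos_60 sin_60)
    moreover have "Arg (cis (pi / 3)) = pi / 3" by (rule Arg_cis) auto
    ultimately have nz: "norm z = 1" and A: "Arg z = pi / 3" by simp_all
    have "Arg z \<in> {pi / 3..pi / 2}" unfolding A by simp
    thus ?thesis using z nz unfolding fundamental_domain_def by blast
  next
    case False
    hence "(sqrt 3 / 2)\<^sup>2 < t\<^sup>2" using t(2) by (intro power_strict_mono) auto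
    hence "1 / 4 + t\<^sup>2 > 1" by (simp add: power_divide)
    hence "norm z > 1" unfolding t norm_half_line by simp
    thus ?thesis using z by (auto simp: fundamental_domain_def t)
  qed
qed

lemma inj_on_nome_fundamental_domain: "inj_on nome fundamental_domain"
proof (rule inj_onI)
  fix z w assume zw: "z \<in> fundamental_domain" "w \<in> fundamental_domain" "nome z = nome w"
  then obtain n where "2 * of_real pi * \<i> * z = 2 * of_real pi * \<i> * w + of_int (2 * n) * of_real pi * \<i>"
    unfolding exp_eq by auto
  hence "2 * of_real pi * \<i> * z = 2 * of_real pi * \<i> * (w + of_int n)"
    by (simp add: algebra_simps)
  hence eq: "z = w + of_int n" by simp
  hence "Re z = Re w + of_int n" by simp
  hence "\<bar>real_of_int n\<bar> < 1"
    using fundamental_domainD[OF zw(1)] fundamental_domainD[OF zw(2)] by linarith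
  thus "z = w" using eq by simp
qed

text \<open>The logarithm from \<open>zero_count_disc\<close> for the nome radii belonging to the
  heights sqrt 3 / 2 (\<open>\<rho>\<close>) and 1/3 (\<open>R\<close>).\<close>

definition zero_count_const :: real where
  "zero_count_const = ln ((exp (- 2 * pi / 3) - exp (- pi * sqrt 3)) / (2 * exp (- pi * sqrt 3)))"

lemma radii_nome:
  "3 * exp (- pi * sqrt 3) < exp (- 2 * pi / 3)" "exp (- 2 * pi / 3) < exp (- 2 * pi * (1 / 4))"
proof -
  have "sqrt 3 > 17 / 10" by (rule real_less_rsqrt) (simp add: power2_eq_square)
  moreover have "pi > 3" using pi_gt3 .
  \<comment> \<open>Here 31/30 = 17/10 - 2/3.\<close>
  ultimately have "3 * (31 / 30) < pi * (sqrt 3 - 2 / 3)" by (intro mult_strict_mono) auto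
  hence "3 < 1 + pi * (sqrt 3 - 2 / 3)" by linarith
  also have "\<dots> \<le> exp (pi * (sqrt 3 - 2 / 3))" by (rule exp_ge_add_one_self)
  finally have "3 * exp (- pi * sqrt 3) < exp (pi * (sqrt 3 - 2 / 3)) * exp (- pi * sqrt 3)"
    by (intro mult_strict_right_mono) auto
  also have "\<dots> = exp (- 2 * pi / 3)" by (simp add: algebra_simps flip: exp_add)
  finally show "3 * exp (- pi * sqrt 3) < exp (- 2 * pi / 3)" .
  show "exp (- 2 * pi / 3) < exp (- 2 * pi * (1 / 4))" by simp
qed

lemma zero_count_const_pos: "zero_count_const > 0"
  unfolding zero_count_const_def using radii_nome(1) by (intro ln_gt_zero) (simp add: field_simps)

text \<open>The nome carries the zeros in the domain injectively, with their orders, to zeros of the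
  factored function \<open>F\<close> in the disc of radius \<open>\<rho>\<close>, where
  \<open>zero_count_disc\<close> applies.\<close>

lemma poincare_zeros_upper_bound:
  assumes "k \<ge> 4" "Im z0 \<ge> sqrt 3 / 2" "poincare_series k m z0 \<noteq> 0"
  defines "Z \<equiv> zeros_in (poincare_series k m) fundamental_domain"
  shows "finite Z"
    and "\<And>z. z \<in> Z \<Longrightarrow> zorder (poincare_series k m) z \<ge> 1"
    and "of_int (zeros_with_mult (poincare_series k m) fundamental_domain) * zero_count_const
           \<le> ln (4 ^ k * (3456 * lattice_const) / norm (poincare_series k m z0))"
proof -
  let ?P = "poincare_series k m"
  define \<rho> where "\<rho> = exp (- pi * sqrt 3)"
  define B where "B = (ball 0 (exp (- 2 * pi * (1 / 4))) :: complex set)"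
  obtain F where F: "F holomorphic_on B" "\<And>z. Im z > 1 / 4 \<Longrightarrow> F (nome z) = ?P z"
    "\<And>q. q \<in> B \<Longrightarrow> norm (F q) \<le> 4 ^ k * (3456 * lattice_const)"
    unfolding B_def
  proof (rule periodic_factor_nome[OF poincare_series_holomorphic[OF assms(1), of m]])
    show "?P (z + 1) = ?P z" if "Im z > 1 / 4" for z using that by (intro poincare_series_plus_1) auto
  qed (use norm_poincare_series_le[OF _ assms(1)] in blast)+
  have "1 / 2 < sqrt 3 / 2" by simp
  hence Im_gt: "Im z > 1 / 4" if "Im z \<ge> sqrt 3 / 2" for z using that by linarith
  have norm_nome: "norm (nome z) \<le> \<rho>" if "Im z \<ge> sqrt 3 / 2" for z
  proof -
    have "2 * pi * (sqrt 3 / 2) \<le> 2 * pi * Im z" using that by (intro mult_left_mono) auto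
    thus ?thesis by (simp add: norm_exp_eq_Re \<rho>_def)
  qed
  have \<rho>: "0 < \<rho>" "3 * \<rho> < exp (- 2 * pi / 3)" using radii_nome by (auto simp: \<rho>_def)
  have nomeB: "nome z \<in> B" if "Im z \<ge> sqrt 3 / 2" for z
  proof -
    have "norm (nome z) < exp (- 2 * pi * (1 / 4))" using norm_nome[OF that] \<rho> radii_nome(2) by linarith
    thus ?thesis by (simp only: B_def mem_ball dist_0_norm)
  qed
  have F0: "F (nome z0) = ?P z0" using F(2) Im_gt assms(2) by blast
  have nz: "F (nome z0) \<noteq> 0" using F0 assms(3) by simp
  define V where "V = {w \<in> cball 0 \<rho>. F w = 0}"
  note count = zero_count_disc[OF F(1)[unfolded B_def] F(3)[unfolded B_def] \<rho> radii_nome(2) norm_nome[OF assms(2)] nz]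
  have ZD: "Im z \<ge> sqrt 3 / 2" "?P z = 0" "z \<in> fundamental_domain" if "z \<in> Z" for z
    using that fundamental_domainD(3) by (auto simp: Z_def zeros_in_def)
  have inj: "inj_on nome Z"
    using inj_on_nome_fundamental_domain by (rule inj_on_subset) (use ZD in auto)
  have img: "nome ` Z \<subseteq> V"
    using ZD norm_nome F(2) Im_gt by (auto simp: V_def)
  have finV: "finite V" using count(1) by (simp add: V_def)
  show finZ: "finite Z" using finite_imageD[OF finite_subset[OF img finV] inj] .
  have ord: "zorder ?P z = zorder F (nome z)" if "z \<in> Z" for z
  proof -
    have "eventually (\<lambda>w. w \<in> {w. Im w > 1 / 4}) (nhds z)"
      using Im_gt ZD(1)[OF that] by (intro eventually_nhds_in_open open_halfspace_Im_gt) auto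
    hence "eventually (\<lambda>w. F (nome w) = ?P w) (at z)"
      using F(2) by (auto simp: eventually_at_filter elim!: eventually_mono)
    hence "zorder (\<lambda>w. F (nome w)) z = zorder ?P z" by (rule zorder_cong) simp
    moreover have "zorder (\<lambda>w. F (nome w)) z = zorder F (nome z)"
      using F(1) nomeB[OF assms(2)] nz nomeB[OF ZD(1)[OF that]]
      by (intro zorder_compose_nome) (auto simp: B_def)
    ultimately show ?thesis by simp
  qed
  have Vpos: "zorder F w > 0" if "w \<in> V" for w
  proof -
    have "norm w \<le> \<rho>" "F w = 0" using that by (simp_all add: V_def)
    moreover from this have "norm w < exp (- 2 * pi * (1 / 4))" using \<rho> radii_nome(2) by linarith
    ultimately show ?thesis by (intro count(3)) (simp_all only: mem_ball dist_0_norm)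
  qed
  show "zorder ?P z \<ge> 1" if "z \<in> Z" for z
    using Vpos[of "nome z"] ord[OF that] img that by force
  have "zeros_with_mult ?P fundamental_domain = (\<Sum>z\<in>Z. zorder F (nome z))"
    unfolding zeros_with_mult_def Z_def[symmetric] using ord by (intro sum.cong) auto
  also have "\<dots> = (\<Sum>w\<in>nome ` Z. zorder F w)" using inj by (simp add: sum.reindex)
  \<comment> \<open>Any further zeros of \<open>F\<close> in the disc, possibly at
    \<open>q = 0\<close>, only enlarge the sum because their orders are positive.\<close>
  also have "\<dots> \<le> (\<Sum>w\<in>V. zorder F w)"
    using finV img Vpos by (intro sum_mono2) (auto simp: less_imp_le)
  finally have "real_of_int (zeros_with_mult ?P fundamental_domain) * zero_count_const \<le> of_int (\<Sum>w\<in>V. zorder F w) * zero_count_const"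
    using zero_count_const_pos by (intro mult_right_mono) (simp_all only: of_int_le_iff less_imp_le)
  also have "\<dots> \<le> ln (4 ^ k * (3456 * lattice_const) / norm (?P z0))"
    using count(2) by (simp add: V_def zero_count_const_def \<rho>_def F0)
  finally show "of_int (zeros_with_mult ?P fundamental_domain) * zero_count_const
           \<le> ln (4 ^ k * (3456 * lattice_const) / norm (?P z0))" .
qed

section \<open>Growth of the phase and choice of the height\<close>

text \<open>With \<open>R = 1 / 4 + u\<^sup>2\<close> the derivative of the phase is
  \<open>(l - 2 * pi * m * u / R) / R\<close>. The assumption on \<open>m\<close> keeps the
  numerator above \<open>l / 2\<close>, and the mean value theorem concludes.\<close>

lemma phase_diff_ge:
  assumes st: "0 \<le> s" "s < t"
    and x: "\<And>u. s \<le> u \<Longrightarrow> u \<le> t \<Longrightarrow> 2 * pi * m * u / (1 / 4 + u\<^sup>2) \<le> l / 2"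
    and r: "sqrt (1 / 4 + t\<^sup>2) \<le> \<rho>"
  shows "phase (2 * l) m t - phase (2 * l) m s \<ge> (t - s) * (l / (2 * \<rho>\<^sup>2))"
proof -
  define D where "D u = real (2 * l) * (2 / (1 + (2 * u)\<^sup>2)) - pi * m * (2 * u) / (1 / 4 + u\<^sup>2)\<^sup>2" for u
  have R: "1 / 4 + u\<^sup>2 > 0" for u :: real by (simp add: add_pos_nonneg)
  have der: "(phase (2 * l) m has_real_derivative D u) (at u)" for u
  proof -
    have d1: "((\<lambda>t. arctan (2 * t)) has_real_derivative 2 / (1 + (2 * u)\<^sup>2)) (at u)"
      by (auto intro!: derivative_eq_intros simp: divide_inverse)
    have d2: "((\<lambda>t. 1 / 4 + t\<^sup>2) has_real_derivative 2 * u) (at u)"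
      by (auto intro!: derivative_eq_intros)
    have d3: "((\<lambda>t. pi * m / (1 / 4 + t\<^sup>2)) has_real_derivative - (pi * m * (2 * u)) / (1 / 4 + u\<^sup>2)\<^sup>2) (at u)"
      using DERIV_divide[OF DERIV_const d2, of "pi * m"] R[of u] by (simp add: power2_eq_square)
    show ?thesis
      unfolding phase_def[abs_def] D_def using DERIV_add[OF DERIV_cmult[OF d1, of "real (2 * l)"] d3]
      by simp
  qed
  obtain u where u: "s < u" "u < t" "phase (2 * l) m t - phase (2 * l) m s = (t - s) * D u"
    using MVT2[OF st(2), of "phase (2 * l) m" D] der by blast
  define R where "R = 1 / 4 + u\<^sup>2"
  have Rpos: "R > 0" by (simp add: R_def add_pos_nonneg)
  have "u\<^sup>2 \<le> t\<^sup>2" using u st by (intro power_mono) auto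
  hence "R \<le> 1 / 4 + t\<^sup>2" by (simp add: R_def)
  also have "\<dots> = (sqrt (1 / 4 + t\<^sup>2))\<^sup>2" by simp
  also have "\<dots> \<le> \<rho>\<^sup>2" using r by (intro power_mono) auto
  finally have R\<rho>: "R \<le> \<rho>\<^sup>2" .
  have "D u = (l - 2 * pi * m * u / R) / R"
  proof -
    have "1 + (2 * u)\<^sup>2 = 4 * R" by (simp add: R_def power_mult_distrib)
    thus ?thesis using Rpos unfolding D_def R_def[symmetric] by (simp add: field_simps power2_eq_square)
  qed
  also have "\<dots> \<ge> (l / 2) / R"
    using x[of u] u Rpos by (intro divide_right_mono) (auto simp: R_def)
  also have "(l / 2) / R \<ge> (l / 2) / \<rho>\<^sup>2"
    using R\<rho> Rpos order.strict_trans2[OF Rpos R\<rho>] by (intro divide_left_mono mult_pos_pos) auto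
  finally have "D u \<ge> l / (2 * \<rho>\<^sup>2)" by simp
  thus ?thesis unfolding u(3) using st by (intro mult_left_mono) auto
qed

text \<open>In terms of \<open>k = 2 * l\<close>, the integer \<open>m\<close> lies between half and
  twice \<alpha> k. A large \<open>t\<close> makes the exponent \<open>x\<close> of the amplitude
  small against \<open>l\<close>, while \<open>exp (- 2 * pi * m * t)\<close> still beats the power
  of \<open>|z|\<close>, since \<open>t\<close> outgrows \<open>ln t\<close>.\<close>

lemma amp_dominates:
  assumes t: "t \<ge> 1" "16 * pi * \<alpha> \<le> t" "ln (t + 1) + 5 / 4 \<le> pi * \<alpha> * t"
    and m: "\<alpha> * l \<le> m" "m \<le> 4 * \<alpha> * l"
  shows "2 * pi * m * t / (1 / 4 + t\<^sup>2) \<le> l / 2"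
    and "exp (- 2 * pi * m * t) \<le> amp (2 * l) m t * exp (- 2 * real l)"
proof -
  define r where "r = sqrt (1 / 4 + t\<^sup>2)"
  define x where "x = 2 * pi * m * t / (1 / 4 + t\<^sup>2)"
  have "x \<le> 2 * pi * m * t / t\<^sup>2"
    unfolding x_def using t by (intro divide_left_mono) (auto simp: add_pos_nonneg intro!: mult_pos_pos)
  also have "\<dots> = 2 * pi * m / t" using t by (simp add: power2_eq_square)
  also have "\<dots> \<le> 2 * pi * (4 * \<alpha> * l) / t"
    using t m by (intro divide_right_mono mult_left_mono) auto
  also have "\<dots> \<le> l / 2"
  proof -
    have "16 * pi * \<alpha> * l \<le> t * l" using t by (intro mult_right_mono) auto
    thus ?thesis using t by (simp add: field_simps)
  qed
  finally have x: "x \<le> l / 2" .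
  thus "2 * pi * m * t / (1 / 4 + t\<^sup>2) \<le> l / 2" by (simp add: x_def)
  have r: "r > 0" by (simp add: r_def add_pos_nonneg)
  have "r \<le> t + 1" unfolding r_def using t by (intro real_le_lsqrt) (auto simp: power2_eq_square algebra_simps)
  hence "ln r \<le> ln (t + 1)" using r by (subst ln_le_cancel_iff) auto
  \<comment> \<open>The summand 5/4 yields \<open>5 * l / 2\<close>: a part \<open>l / 2\<close>
    absorbs \<open>x\<close>, and \<open>2 * l\<close> remains as the gain.\<close>
  hence "2 * l * (ln r + 5 / 4) \<le> 2 * l * (pi * \<alpha> * t)" using t by (intro mult_left_mono) auto
  also have "\<dots> = 2 * pi * (\<alpha> * l) * t" by simp
  also have "\<dots> \<le> 2 * pi * m * t" using m t by (intro mult_right_mono mult_left_mono) auto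
  finally have "- 2 * pi * m * t \<le> - x - 2 * l * ln r - 2 * l" using x by (simp add: algebra_simps)
  hence "exp (- 2 * pi * m * t) \<le> exp (- x - 2 * l * ln r - 2 * l)" by simp
  also have "\<dots> = exp (- x) * inverse (exp (real (2 * l) * ln r)) * exp (- 2 * real l)"
    by (simp flip: exp_add exp_minus)
  also have "exp (real (2 * l) * ln r) = r ^ (2 * l)"
    using r by (subst exp_of_nat_mult) simp
  finally show "exp (- 2 * pi * m * t) \<le> amp (2 * l) m t * exp (- 2 * real l)"
    unfolding amp_def x_def r_def divide_inverse .
qed

lemma exists_dominating_height:
  assumes "\<alpha> > 0"
  obtains T :: real where "T \<ge> 1"
    "\<And>t. t \<ge> T \<Longrightarrow> 16 * pi * \<alpha> \<le> t" "\<And>t. t \<ge> T \<Longrightarrow> ln (t + 1) + 5 / 4 \<le> pi * \<alpha> * t"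
proof -
  have "eventually (\<lambda>x :: real. ln x / x < pi * \<alpha> / 4) at_top"
    using assms by (intro order_tendstoD(2)[OF ln_x_over_x_tendsto_0]) auto
  then obtain X where X: "\<And>x. x \<ge> X \<Longrightarrow> ln x / x < pi * \<alpha> / 4"
    by (auto simp: eventually_at_top_linorder)
  \<comment> \<open>The entry \<open>X\<close> bounds \<open>ln (t + 1)\<close> by
    \<open>pi * \<alpha> * t / 2\<close>, and the last entry does the same for 5/4.\<close>
  define T where "T = Max {1, 16 * pi * \<alpha>, X, 5 / (2 * (pi * \<alpha>))}"
  show ?thesis
  proof (rule that[of T])
    show "1 \<le> T" by (simp add: T_def)
    fix t assume "t \<ge> T"
    hence t: "1 \<le> t" "16 * pi * \<alpha> \<le> t" "X \<le> t" "5 / (2 * (pi * \<alpha>)) \<le> t" by (simp_all add: T_def)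
    show "16 * pi * \<alpha> \<le> t" by fact
    have "ln (t + 1) / (t + 1) < pi * \<alpha> / 4" using X[of "t + 1"] t by simp
    hence "ln (t + 1) \<le> pi * \<alpha> / 4 * (t + 1)" using t by (simp add: divide_less_eq)
    also have "\<dots> \<le> pi * \<alpha> / 4 * (2 * t)" using t assms by (intro mult_left_mono) auto
    finally have "ln (t + 1) \<le> pi * \<alpha> * t / 2" by simp
    moreover have "5 \<le> t * (2 * (pi * \<alpha>))" using t(4) assms by (simp add: divide_le_eq)
    ultimately show "ln (t + 1) + 5 / 4 \<le> pi * \<alpha> * t" by (simp add: mult_ac)
  qed
qed

section \<open>Linear bounds for the numbers of zeros\<close>

lemma poincare_series_zeros_linear:
  assumes "\<alpha> > 0"
  obtains c C :: real and K :: nat where "c > 0" "C > 0"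
    "\<And>l m. l \<ge> K \<Longrightarrow> \<alpha> * real l \<le> real m \<Longrightarrow> real m \<le> 4 * \<alpha> * real l \<Longrightarrow>
       finite (zeros_in (poincare_series (2 * l) m) fundamental_domain) \<and>
       (\<forall>z\<in>zeros_in (poincare_series (2 * l) m) fundamental_domain. zorder (poincare_series (2 * l) m) z \<ge> 1) \<and>
       c * real l \<le> real (card (zeros_in (poincare_series (2 * l) m) L_rho)) \<and>
       of_int (zeros_with_mult (poincare_series (2 * l) m) fundamental_domain) \<le> C * real l"
proof -
  obtain T where T: "T \<ge> 1" "\<And>t. t \<ge> T \<Longrightarrow> 16 * pi * \<alpha> \<le> t"
    "\<And>t. t \<ge> T \<Longrightarrow> ln (t + 1) + 5 / 4 \<le> pi * \<alpha> * t"
    using exists_dominating_height[OF assms] by blast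
  \<comment> \<open>An upper bound for \<open>|z|\<close> on the whole segment, since
    \<open>|half_line t| \<le> t + 1\<close> and \<open>t \<le> T + 1\<close>.\<close>
  define \<rho> where "\<rho> = T + 2"
  define Q where "Q = \<rho> / sqrt (\<rho>\<^sup>2 + 2)"
  define E where "E n = 864 * lattice_const * \<rho> ^ 4 * Q ^ n" for n
  have \<rho>: "\<rho> \<ge> 3" using T(1) by (simp add: \<rho>_def)
  have lt: "\<rho> < sqrt (\<rho>\<^sup>2 + 2)" by (rule real_less_rsqrt) simp
  hence pos: "0 < sqrt (\<rho>\<^sup>2 + 2)" using \<rho> by linarith
  have Q: "0 \<le> Q" "Q < 1"
    using divide_less_eq_1_pos[OF pos, of \<rho>] lt divide_nonneg_pos[OF _ pos, of \<rho>] \<rho> by (simp_all only: Q_def)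
  have "E \<longlonglongrightarrow> 864 * lattice_const * \<rho> ^ 4 * 0"
    unfolding E_def using Q by (intro tendsto_mult tendsto_const LIMSEQ_power_zero) auto
  hence "eventually (\<lambda>n. E n < 1 / 2) sequentially"
    by (intro order_tendstoD(2)) auto
  then obtain N0 where N0: "\<And>n. n \<ge> N0 \<Longrightarrow> E n < 1 / 2"
    by (auto simp: eventually_at_top_linorder)
  \<comment> \<open>The first entry makes the tail \<open>E (l - 4)\<close> less than 1/2. The
    second makes half of the phase growth absorb the two zeros lost to rounding.\<close>
  define K where "K = max (N0 + 4) (nat \<lceil>8 * pi * \<rho>\<^sup>2\<rceil>)"
  \<comment> \<open>The base of the exponential bound for the quotient of the upper bound and the
    value at \<open>t0\<close>: 16 is 4^2 and the last factor comes from the lower bound on the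
    amplitude. Adding 1 to the lattice constant lets its \<open>l\<close>-th power replace
    it.\<close>
  define D where "D = 16 * (3456 * lattice_const + 1) * (exp (1 / 2) * \<rho>\<^sup>2)"
  have D: "D > 1"
  proof -
    have "\<rho> ^ 2 \<ge> 1" using \<rho> by simp
    moreover have "exp (1 / 2) \<ge> (1 :: real)" by simp
    ultimately have h1: "1 * 1 \<le> exp (1 / 2) * \<rho>\<^sup>2" by (intro mult_mono) auto
    have h2: "1 \<le> 3456 * lattice_const + 1" using lattice_const_nonneg by simp
    have "1 * (1 * 1) \<le> (3456 * lattice_const + 1) * (exp (1 / 2) * \<rho>\<^sup>2)"
      by (rule mult_mono[OF h2 h1]) (use lattice_const_nonneg in auto)
    thus ?thesis unfolding D_def mult.assoc by linarith
  qed
  show ?thesis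
  proof (rule that[of "1 / (4 * pi * \<rho>\<^sup>2)" "ln D / zero_count_const" K])
    show "1 / (4 * pi * \<rho>\<^sup>2) > 0" using \<rho> by simp
    show "ln D / zero_count_const > 0" using D zero_count_const_pos by simp
    fix l m :: nat
    assume l: "l \<ge> K" and m: "\<alpha> * real l \<le> real m" "real m \<le> 4 * \<alpha> * real l"
    let ?P = "poincare_series (2 * l) m"
    let ?a = "amp (2 * l) m"
    let ?\<theta> = "phase (2 * l) m"
    have l4: "l \<ge> 4" "l - 4 \<ge> N0" using l by (auto simp: K_def)
    have l_ge: "real l \<ge> 8 * pi * \<rho>\<^sup>2" using l unfolding K_def by linarith
    have r: "sqrt (1 / 4 + t\<^sup>2) \<le> \<rho>" if "T \<le> t" "t \<le> T + 1" for t
    proof -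
      have "sqrt (1 / 4 + t\<^sup>2) \<le> t + 1"
        using that T(1) by (intro real_le_lsqrt) (auto simp: power2_eq_square algebra_simps)
      thus ?thesis using that by (simp add: \<rho>_def)
    qed
    have x: "2 * pi * m * t / (1 / 4 + t\<^sup>2) \<le> l / 2" if "T \<le> t" for t
      using that T m by (intro amp_dominates(1)[where \<alpha> = \<alpha>]) auto
    have close: "norm (?P (half_line t) - of_real (2 * ?a t * cos (?\<theta> t))) < ?a t"
      if t: "T \<le> t" "t \<le> T + 1" for t
    proof -
      have "norm (?P (half_line t) - of_real (2 * ?a t * cos (?\<theta> t))) \<le> exp (- 2 * pi * m * t) + ?a t * E (l - 4)"
        unfolding E_def Q_def using t T(1) l4 by (intro poincare_series_approx x r) auto
      also have "exp (- 2 * pi * m * t) \<le> ?a t * exp (- 2 * real l)"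
        using t T m by (intro amp_dominates(2)[where \<alpha> = \<alpha>]) auto
      also have "exp (- 2 * real l) \<le> 1 / 2"
      proof -
        have "2 \<le> 1 + 2 * real l" using l4 by simp
        also have "\<dots> \<le> exp (2 * real l)" by (rule exp_ge_add_one_self)
        finally have "inverse (exp (2 * real l)) \<le> inverse 2" by (intro le_imp_inverse_le) auto
        thus ?thesis by (simp add: exp_minus)
      qed
      also have "E (l - 4) < 1 / 2" using N0 l4 by blast
      finally show ?thesis using amp_pos[of "2 * l" m t] by (simp add: mult_left_mono mult_strict_left_mono)
    qed
    have mono: "?\<theta> t - ?\<theta> s \<ge> (t - s) * (l / (2 * \<rho>\<^sup>2))" if "T \<le> s" "s < t" "t \<le> T + 1" for s t
      using that T(1) by (intro phase_diff_ge x r) auto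
    have lpos: "l / (2 * \<rho>\<^sup>2) > 0" using l4 \<rho> by simp
    have mono': "?\<theta> s < ?\<theta> t" if "T \<le> s" "s < t" "t \<le> T + 1" for s t
    proof -
      have "0 < (t - s) * (l / (2 * \<rho>\<^sup>2))" using that lpos by (intro mult_pos_pos) auto
      thus ?thesis using mono[OF that] by linarith
    qed
    have \<Delta>: "?\<theta> (T + 1) - ?\<theta> T \<ge> l / (2 * \<rho>\<^sup>2)" using mono[of T "T + 1"] by simp
    have cont\<theta>: "continuous_on {T..T + 1} ?\<theta>"
      unfolding phase_def by (intro continuous_intros) (auto simp: add_nonneg_eq_0_iff)
    have "continuous_on {z. Im z > 1 / 4} ?P"
      using l4 by (intro holomorphic_on_imp_continuous_on poincare_series_holomorphic) auto
    moreover have "continuous_on {T..T + 1} half_line" by (intro continuous_intros)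
    moreover have "half_line ` {T..T + 1} \<subseteq> {z. Im z > 1 / 4}" using T(1) by auto
    ultimately have contP: "continuous_on {T..T + 1} (\<lambda>t. Re (?P (half_line t)))"
      by (intro continuous_on_Re) (rule continuous_on_compose2)
    have real: "?P (half_line t) = of_real (Re (?P (half_line t)))" if "T \<le> t" for t
    proof -
      have "cnj (?P (half_line t)) = ?P (half_line t)"
        using that T(1) by (intro cnj_poincare_series_half) auto
      thus ?thesis by (metis Reals_cnj_iff of_real_Re)
    qed
    have close': "\<bar>Re (?P (half_line t)) - 2 * ?a t * cos (?\<theta> t)\<bar> < ?a t" if "T \<le> t" "t \<le> T + 1" for t
    proof -
      have "\<bar>Re (?P (half_line t) - of_real (2 * ?a t * cos (?\<theta> t)))\<bar> < ?a t"
        using close[OF that] abs_Re_le_cmod by (rule order.strict_trans1[rotated])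
      thus ?thesis by simp
    qed
    \<comment> \<open>The sign changes need only an error below \<open>2 * ?a t\<close>; the
      stronger bound by \<open>?a t\<close> is kept for the lower bound on a value of the
      series.\<close>
    have close'': "\<bar>Re (?P (half_line t)) - 2 * ?a t * cos (?\<theta> t)\<bar> < 2 * ?a t" if "T \<le> t" "t \<le> T + 1" for t
      using close'[OF that] amp_pos[of "2 * l" m t] by linarith
    have "T \<le> T + 1" by simp
    from card_zeros_oscillating[OF this contP cont\<theta> mono' close'']
    obtain S where S: "finite S" "S \<subseteq> {T..T + 1}" "\<And>t. t \<in> S \<Longrightarrow> Re (?P (half_line t)) = 0"
      "real (card S) \<ge> (?\<theta> (T + 1) - ?\<theta> T) / pi - 2" by blast
    have "sqrt 3 / 2 \<le> 1" by (simp add: real_le_lsqrt)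
    hence T_ge: "sqrt 3 / 2 \<le> t" if "T \<le> t" for t using that T(1) by linarith

    \<comment> \<open>The phase grows by at least pi, hence passes a multiple of pi. There the main
      part has modulus \<open>2 * ?a t\<close> and the error takes away less than
      \<open>?a t\<close>.\<close>
    have "\<exists>t\<ge>T. t \<le> T + 1 \<and> norm (?P (half_line t)) \<ge> ?a t"
    proof -
      define j where "j = \<lceil>?\<theta> T / pi\<rceil>"
      have j: "?\<theta> T / pi \<le> of_int j" "of_int j \<le> ?\<theta> T / pi + 1" unfolding j_def by linarith+
      have "pi \<le> 4 * pi" by simp
      also have "4 * pi \<le> l / (2 * \<rho>\<^sup>2)" using l_ge \<rho> by (simp add: field_simps)
      also note \<Delta>
      finally have "?\<theta> T + pi \<le> ?\<theta> (T + 1)" by simp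
      hence "?\<theta> T \<le> of_int j * pi" "of_int j * pi \<le> ?\<theta> (T + 1)"
        using j by (auto simp: field_simps)
      then obtain t where t: "T \<le> t" "t \<le> T + 1" "?\<theta> t = of_int j * pi"
        using IVT'[of ?\<theta> T "of_int j * pi" "T + 1"] cont\<theta> by auto
      have "\<bar>cos (?\<theta> t)\<bar> = 1" unfolding t(3) mult.commute[of _ pi] cos_npi_int by simp
      hence "\<bar>2 * ?a t * cos (?\<theta> t)\<bar> = 2 * ?a t"
        using amp_pos[of "2 * l" m t] by (simp add: abs_mult)
      hence "\<bar>Re (?P (half_line t))\<bar> \<ge> ?a t" using close'[OF t(1,2)] by linarith
      thus ?thesis using t abs_Re_le_cmod[of "?P (half_line t)"] by (intro exI[of _ t]) auto
    qed
    then obtain t0 where t0: "T \<le> t0" "t0 \<le> T + 1" "norm (?P (half_line t0)) \<ge> ?a t0" by blast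
    have nz: "?P (half_line t0) \<noteq> 0" using t0(3) amp_pos[of "2 * l" m t0] by auto
    have "2 * l \<ge> 4" "Im (half_line t0) \<ge> sqrt 3 / 2" using l4 T_ge[OF t0(1)] by auto
    note ub = poincare_zeros_upper_bound[OF this nz]

    have "finite (zeros_in ?P L_rho)"
      using L_rho_subset_fundamental_domain
      by (intro finite_subset[OF _ ub(1)]) (auto simp: zeros_in_def)
    moreover have "half_line ` S \<subseteq> zeros_in ?P L_rho"
    proof
      fix z assume "z \<in> half_line ` S"
      then obtain t where t: "z = half_line t" "t \<in> S" by blast
      hence "T \<le> t" using S(2) by auto
      thus "z \<in> zeros_in ?P L_rho"
        using real[of t] S(3)[OF t(2)] T_ge[of t] by (auto simp: zeros_in_def L_rho_def t(1))
    qed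
    ultimately have "card (half_line ` S) \<le> card (zeros_in ?P L_rho)" by (rule card_mono)
    moreover have "card (half_line ` S) = card S" by (intro card_image) (auto simp: inj_on_def)
    ultimately have card_ge: "real (card (zeros_in ?P L_rho)) \<ge> (?\<theta> (T + 1) - ?\<theta> T) / pi - 2"
      using S(4) by simp
    have "1 / (4 * pi * \<rho>\<^sup>2) * l \<le> l / (2 * \<rho>\<^sup>2) / pi - 2"
      using l_ge \<rho> by (simp add: field_simps)
    also have "\<dots> \<le> (?\<theta> (T + 1) - ?\<theta> T) / pi - 2" using \<Delta> by (intro diff_right_mono divide_right_mono) auto
    also note card_ge
    finally have lower: "1 / (4 * pi * \<rho>\<^sup>2) * real l \<le> real (card (zeros_in ?P L_rho))" .

    have "4 ^ (2 * l) * (3456 * lattice_const) / norm (?P (half_line t0)) \<le> D ^ l"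
    proof -
      \<comment> \<open>Uses \<open>x \<le> l / 2\<close> in the exponential and
        \<open>|z| \<le> \<rho>\<close> in the denominator.\<close>
      have "?a t0 \<ge> exp (- (l / 2)) / \<rho> ^ (2 * l)"
        unfolding amp_def using x[OF t0(1)] r[OF t0(1,2)] \<rho>
        by (intro frac_le power_mono) (auto simp: add_pos_nonneg)
      moreover have "exp (- (l / 2)) / \<rho> ^ (2 * l) = 1 / (exp (1 / 2) * \<rho>\<^sup>2) ^ l"
        by (simp add: power_mult_distrib power_mult exp_minus field_simps flip: exp_of_nat_mult) (simp add: mult.commute flip: power_mult)
      ultimately have P: "norm (?P (half_line t0)) \<ge> 1 / (exp (1 / 2) * \<rho>\<^sup>2) ^ l" using t0(3) by linarith
      have pos: "(exp (1 / 2) * \<rho>\<^sup>2) ^ l > 0" using \<rho> by simp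
      have "4 ^ (2 * l) * (3456 * lattice_const) / norm (?P (half_line t0))
          \<le> 4 ^ (2 * l) * (3456 * lattice_const + 1) ^ l / (1 / (exp (1 / 2) * \<rho>\<^sup>2) ^ l)"
      proof (intro frac_le mult_left_mono P)
        have "3456 * lattice_const \<le> (3456 * lattice_const + 1) ^ 1" by simp
        also have "\<dots> \<le> (3456 * lattice_const + 1) ^ l"
          using l4 lattice_const_nonneg by (intro power_increasing) auto
        finally show "3456 * lattice_const \<le> (3456 * lattice_const + 1) ^ l" .
      qed (use pos lattice_const_nonneg in auto)
      also have "\<dots> = D ^ l" unfolding D_def power_mult_distrib by (simp add: power_mult)
      finally show ?thesis .
    qed
    \<comment> \<open>The logarithm needs strict positivity, which follows because the expression
      bounds a nonzero value of the series.\<close>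
    moreover have "4 ^ (2 * l) * (3456 * lattice_const) > 0"
    proof -
      have "norm (?P (half_line t0)) \<le> 4 ^ (2 * l) * (3456 * lattice_const)"
        using l4 t0 T(1) by (intro norm_poincare_series_le) auto
      moreover have "norm (?P (half_line t0)) > 0" using nz by simp
      ultimately show ?thesis by linarith
    qed
    ultimately have "ln (4 ^ (2 * l) * (3456 * lattice_const) / norm (?P (half_line t0))) \<le> ln (D ^ l)"
      using nz D by (subst ln_le_cancel_iff) auto
    also have "\<dots> = l * ln D" using D by (simp add: ln_realpow)
    finally have "of_int (zeros_with_mult ?P fundamental_domain) * zero_count_const \<le> l * ln D"
      using ub(3) by linarith
    hence "of_int (zeros_with_mult ?P fundamental_domain) \<le> ln D / zero_count_const * l"
      using zero_count_const_pos by (simp add: field_simps)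
    thus "finite (zeros_in ?P fundamental_domain) \<and>
       (\<forall>z\<in>zeros_in ?P fundamental_domain. zorder ?P z \<ge> 1) \<and>
       1 / (4 * pi * \<rho>\<^sup>2) * real l \<le> real (card (zeros_in ?P L_rho)) \<and>
       of_int (zeros_with_mult ?P fundamental_domain) \<le> ln D / zero_count_const * real l"
      using ub(1,2) lower by blast
  qed
qed

lemma card_zeros_le_zeros_with_mult:
  assumes "\<And>z. z \<in> zeros_in f S \<Longrightarrow> zorder f z \<ge> 1"
  shows "int (card (zeros_in f S)) \<le> zeros_with_mult f S"
  unfolding zeros_with_mult_def using sum_bounded_below[of "zeros_in f S" "1 :: int" "zorder f"] assms
  by simp

text \<open>Distinct zeros on the line are compared with zeros of the domain counted with
  multiplicity. As all orders are at least 1, this one inequality settles the proportion under both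
  ways of counting.\<close>

theorem theorem1p1:
  fixes \<alpha> :: real
  assumes "\<alpha> > 0"
  shows "\<exists>P_rho > 0. \<exists>\<delta> > 0. \<forall>m :: nat \<Rightarrow> nat.
    (\<forall>k. even k \<and> k > 0 \<longrightarrow> m k > 0) \<longrightarrow>
    (\<lambda>k. real (m k) - \<alpha> * real k) \<in> o[even_at_top](\<lambda>k. real k) \<longrightarrow>
      (\<exists>err :: nat \<Rightarrow> real. err \<in> o[even_at_top](\<lambda>k. real k) \<and>
        (\<forall>\<^sub>F k in even_at_top.
          real (card (zeros_in (poincare_series k (m k)) L_rho)) \<ge> P_rho * (real k / 12) + err k)) \<and>
      (\<forall>\<^sub>F k in even_at_top.
        finite (zeros_in (poincare_series k (m k)) fundamental_domain) \<and>
        real (card (zeros_in (poincare_series k (m k)) L_rho)) \<ge>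
          \<delta> * real (card (zeros_in (poincare_series k (m k)) fundamental_domain)) \<and>
        of_int (zeros_with_mult (poincare_series k (m k)) L_rho) \<ge>
          \<delta> * of_int (zeros_with_mult (poincare_series k (m k)) fundamental_domain))"
proof -
  obtain c C :: real and K :: nat where c: "c > 0" "C > 0" and main:
    "\<And>l m. l \<ge> K \<Longrightarrow> \<alpha> * real l \<le> real m \<Longrightarrow> real m \<le> 4 * \<alpha> * real l \<Longrightarrow>
       finite (zeros_in (poincare_series (2 * l) m) fundamental_domain) \<and>
       (\<forall>z\<in>zeros_in (poincare_series (2 * l) m) fundamental_domain. zorder (poincare_series (2 * l) m) z \<ge> 1) \<and>
       c * real l \<le> real (card (zeros_in (poincare_series (2 * l) m) L_rho)) \<and>
       of_int (zeros_with_mult (poincare_series (2 * l) m) fundamental_domain) \<le> C * real l"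
    using poincare_series_zeros_linear[OF assms] by metis
  define \<delta> where "\<delta> = c / C"
  have \<delta>: "\<delta> > 0" using c by (simp add: \<delta>_def)
  have ev: "\<forall>\<^sub>F k in even_at_top.
      real (card (zeros_in (poincare_series k (m k)) L_rho)) \<ge> 6 * c * (real k / 12) \<and>
      finite (zeros_in (poincare_series k (m k)) fundamental_domain) \<and>
      real (card (zeros_in (poincare_series k (m k)) L_rho)) \<ge>
        \<delta> * real (card (zeros_in (poincare_series k (m k)) fundamental_domain)) \<and>
      of_int (zeros_with_mult (poincare_series k (m k)) L_rho) \<ge>
        \<delta> * of_int (zeros_with_mult (poincare_series k (m k)) fundamental_domain)"
    if m: "(\<lambda>k. real (m k) - \<alpha> * real k) \<in> o[even_at_top](\<lambda>k. real k)" for m :: "nat \<Rightarrow> nat"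
  proof -
    \<comment> \<open>With relative error 1/2 and \<open>k = 2 * l\<close>, \<open>m k\<close> lies
      between \<open>\<alpha> * l\<close> and \<open>3 * \<alpha> * l\<close>, inside the range of
      \<open>main\<close>.\<close>
    have "\<forall>\<^sub>F k in even_at_top. norm (real (m k) - \<alpha> * real k) \<le> \<alpha> / 2 * norm (real k)"
      using assms by (intro landau_o.smallD[OF m]) auto
    moreover have "\<forall>\<^sub>F k in even_at_top. even k \<and> k \<ge> 2 * K"
      unfolding even_at_top_def eventually_inf_principal
      using eventually_ge_at_top[of "2 * K"] by eventually_elim auto
    ultimately show ?thesis
    proof eventually_elim
      case (elim k)
      then obtain l where k: "k = 2 * l" by auto
      let ?P = "poincare_series k (m k)"
      have "\<alpha> * real l \<le> real (m k)" "real (m k) \<le> 4 * \<alpha> * real l"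
        using elim(1) assms by (auto simp: k abs_le_iff field_simps)
      with main[of l "m k"] elim k
      have fin: "finite (zeros_in ?P fundamental_domain)"
        and ord: "\<And>z. z \<in> zeros_in ?P fundamental_domain \<Longrightarrow> zorder ?P z \<ge> 1"
        and lower: "c * real l \<le> real (card (zeros_in ?P L_rho))"
        and upper: "of_int (zeros_with_mult ?P fundamental_domain) \<le> C * real l"
        by auto
      have "zeros_in ?P L_rho \<subseteq> zeros_in ?P fundamental_domain"
        using L_rho_subset_fundamental_domain by (auto simp: zeros_in_def)
      hence L: "int (card (zeros_in ?P L_rho)) \<le> zeros_with_mult ?P L_rho"
        using ord by (intro card_zeros_le_zeros_with_mult) auto
      have F: "int (card (zeros_in ?P fundamental_domain)) \<le> zeros_with_mult ?P fundamental_domain"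
        using ord by (rule card_zeros_le_zeros_with_mult)
      have "\<delta> * of_int (zeros_with_mult ?P fundamental_domain) \<le> \<delta> * (C * real l)"
        using \<delta> upper by (intro mult_left_mono) auto
      also have "\<dots> = c * real l" using c by (simp add: \<delta>_def)
      also note lower
      finally have *: "\<delta> * of_int (zeros_with_mult ?P fundamental_domain) \<le> real (card (zeros_in ?P L_rho))" .
      moreover have "real (card (zeros_in ?P L_rho)) \<le> of_int (zeros_with_mult ?P L_rho)"
        using L by linarith
      moreover have "\<delta> * real (card (zeros_in ?P fundamental_domain)) \<le>
          \<delta> * of_int (zeros_with_mult ?P fundamental_domain)"
        using \<delta> F by (intro mult_left_mono) linarith+
      ultimately show ?case using fin lower by (simp add: k)
    qed
  qed
  show ?thesis
  \<comment> \<open>The factor 6 converts \<open>c * l\<close> with \<open>l = k / 2\<close> into a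
    multiple of \<open>k / 12\<close>. The bound is exact for large \<open>k\<close>, so
    \<open>err\<close> is zero.\<close>
  proof (rule exI[of _ "6 * c"], rule conjI, use c in simp, rule exI[of _ \<delta>], intro conjI allI impI)
    fix m :: "nat \<Rightarrow> nat"
    assume m: "(\<lambda>k. real (m k) - \<alpha> * real k) \<in> o[even_at_top](\<lambda>k. real k)"
    show "\<exists>err :: nat \<Rightarrow> real. err \<in> o[even_at_top](\<lambda>k. real k) \<and>
        (\<forall>\<^sub>F k in even_at_top.
          real (card (zeros_in (poincare_series k (m k)) L_rho)) \<ge> 6 * c * (real k / 12) + err k)"
      using ev[OF m] by (intro exI[of _ "\<lambda>_. 0"]) (auto elim!: eventually_mono)
    show "\<forall>\<^sub>F k in even_at_top.
        finite (zeros_in (poincare_series k (m k)) fundamental_domain) \<and>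
        real (card (zeros_in (poincare_series k (m k)) L_rho)) \<ge>
          \<delta> * real (card (zeros_in (poincare_series k (m k)) fundamental_domain)) \<and>
        of_int (zeros_with_mult (poincare_series k (m k)) L_rho) \<ge>
          \<delta> * of_int (zeros_with_mult (poincare_series k (m k)) fundamental_domain)"
      using ev[OF m] by eventually_elim blast
  qed (use c \<delta> in auto)
qed

end
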